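(* Let $M$ be an irreducible real algebraic variety, let $A,B\subset M$ be disjoint semialgebraic subsets, and let $Z$ be the separation nullspace of $A$ and $B$ in $M$. Assume that $Z\cap(A\cup B)=\emptyset$. Then $A$ and $B$ are separable if and only if they are generically separable.
   Context: For an irreducible real algebraic variety $V$ (real algebraic subset of some $\mathbb{R}^N$), $\mathfrak{R}(V)$ is the ring of regular functions (quotients $p/q$ of polynomial functions with $q$ nowhere zero on $V$). Semialgebraic sets $S,T\subset V$ are separable if there is $f\in\mathfrak{R}(V)$ with $f>0$ on $S$ and $f<0$ on $T$; they are generically separable (in $V$) if there is a non-zero $f\in\mathfrak{R}(V)$ with $f\ge 0$ on $S$ and $f\le 0$ on $T$. For an irreducible algebraic subset $W\subset M$, the shadows of $A$ and $B$ in $W$ are $A_W=\overline A\cap W$ and $B_W=\overline B\cap W$ (Euclidean closures). The separation nullspace $Z$ of $A$ and $B$ is the union of all irreducible algebraic subsets $W\subset M$ such that the shadows $A_W$ and $B_W$ are not generically separable in $W$. *)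

theory Defs
  imports "HOL-Analysis.Analysis"
begin

definition algebraic_set :: "(real^'n) set \<Rightarrow> bool" where
  "algebraic_set V \<longleftrightarrow>
     (\<exists>P. (\<forall>p\<in>P. real_polynomial_function p) \<and> V = {x. \<forall>p\<in>P. p x = 0})"

text \<open>The empty set is not irreducible.\<close>

definition irreducible_algebraic_set :: "(real^'n) set \<Rightarrow> bool" where
  "irreducible_algebraic_set V \<longleftrightarrow> algebraic_set V \<and> V \<noteq> {} \<and>
     (\<forall>V1 V2. algebraic_set V1 \<longrightarrow> algebraic_set V2 \<longrightarrow> V = V1 \<union> V2 \<longrightarrow> V = V1 \<or> V = V2)"

inductive semialgebraic :: "(real^'n) set \<Rightarrow> bool" where
  pos: "real_polynomial_function p \<Longrightarrow> semialgebraic {x. p x > 0}"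
| compl: "semialgebraic S \<Longrightarrow> semialgebraic (- S)"
| inter: "semialgebraic S \<Longrightarrow> semialgebraic T \<Longrightarrow> semialgebraic (S \<inter> T)"
| union: "semialgebraic S \<Longrightarrow> semialgebraic T \<Longrightarrow> semialgebraic (S \<union> T)"

text \<open>A regular function on \<open>V\<close> is represented by any total function with the right values
  on \<open>V\<close>. Values outside \<open>V\<close> are irrelevant, so being non-zero in the ring of regular functions
  means being non-zero at some point of \<open>V\<close>.\<close>

definition regular_functions :: "(real^'n) set \<Rightarrow> (real^'n \<Rightarrow> real) set" where
  "regular_functions V =
     {f. \<exists>p q. real_polynomial_function p \<and> real_polynomial_function q \<and>
           (\<forall>x\<in>V. q x \<noteq> 0 \<and> f x = p x / q x)}"

definition separable_in :: "(real^'n) set \<Rightarrow> (real^'n) set \<Rightarrow> (real^'n) set \<Rightarrow> bool" where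
  "separable_in V S T \<longleftrightarrow>
     (\<exists>f\<in>regular_functions V. (\<forall>x\<in>S. f x > 0) \<and> (\<forall>x\<in>T. f x < 0))"

definition generically_separable_in :: "(real^'n) set \<Rightarrow> (real^'n) set \<Rightarrow> (real^'n) set \<Rightarrow> bool" where
  "generically_separable_in V S T \<longleftrightarrow>
     (\<exists>f\<in>regular_functions V. (\<exists>x\<in>V. f x \<noteq> 0) \<and> (\<forall>x\<in>S. f x \<ge> 0) \<and> (\<forall>x\<in>T. f x \<le> 0))"

definition shadow :: "(real^'n) set \<Rightarrow> (real^'n) set \<Rightarrow> (real^'n) set" where
  "shadow W A = closure A \<inter> W"

definition separation_nullspace :: "(real^'n) set \<Rightarrow> (real^'n) set \<Rightarrow> (real^'n) set \<Rightarrow> (real^'n) set" where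
  "separation_nullspace M A B =
     \<Union>{W. W \<subseteq> M \<and> irreducible_algebraic_set W \<and>
          \<not> generically_separable_in W (shadow W A) (shadow W B)}"

end

theory Submission
  imports Defs
begin

text \<open>
  By Noetherian induction, every algebraic subset \<open>Y\<close> of \<open>M\<close> carries a polynomial that is
  nonnegative on \<open>closure A \<inter> Y\<close>, nonpositive on \<open>closure B \<inter> Y\<close> and whose zeros on these two sets lie
  in the separation nullspace. If every polynomial with these signs vanishes on \<open>Y\<close>, then no
  irreducible component of \<open>Y\<close> has generically separable shadows, so \<open>Y\<close> is contained in the nullspace.
  Otherwise let \<open>a\<close> be such a polynomial, not identically zero on \<open>Y\<close>, and let \<open>g\<close> be one obtained
  for \<open>Y \<inter> {a = 0}\<close>. Where \<open>g\<close> has the wrong sign, the Lojasiewicz inequality bounds a power of \<open>g\<close>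
  by a multiple of \<open>a\<close>, so \<open>2 W a + g\<^sup>2\<^sup>N\<^sup>+\<^sup>1\<close> works on \<open>Y\<close> for a suitable positive polynomial \<open>W\<close>.
  The Lojasiewicz inequality comes from the elimination of quantifiers: the signs of finitely many
  polynomials in \<open>(t, s)\<close> are constant for large \<open>t\<close> and \<open>0 < s < t\<^sup>-\<^sup>N\<close>.
\<close>

subsection \<open>Order automorphisms of the line adjusting signs\<close>

text \<open>The obstacle is that \<open>g\<close> is controlled only on the zero set of
  \<open>a\<close>, while \<open>a\<close> may be arbitrarily small next to that set; a sum has the
  right sign only if \<open>a\<close> is not too small compared with \<open>g\<close>. The
  Lojasiewicz inequality is applied to the points of \<open>A\<close> and \<open>B\<close> where
  \<open>g\<close> has the wrong sign: at a limit of such points that lies in \<open>Y\<close> and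
  satisfies \<open>a = 0\<close>, the sign of \<open>g\<close> is also right, so
  \<open>g = 0\<close>. The exponent is odd so that the power keeps the sign of \<open>g\<close>.

  In the proof of that inequality \<open>t\<close> bounds both the squared norm and
  \<open>1 / g^2\<close>, and \<open>s\<close> is the value to be bounded from below.

  Elimination is done without formulas. If finitely many coefficients have equal signs at two
  parameters, an order automorphism of the line carries the table of signs over one parameter to the
  table over the other. This is where order automorphisms come in.\<close>

lemma sgn_const_of_no_root:
  fixes f :: "real \<Rightarrow> real"
  assumes "connected S" "continuous_on S f" "\<And>x. x \<in> S \<Longrightarrow> f x \<noteq> 0" "x \<in> S" "y \<in> S"
  shows "sgn (f x) = sgn (f y)"
proof -
  have c: "connected (f ` S)" by (intro connected_continuous_image assms)
  have 0: "0 \<notin> f ` S" using assms by auto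
  have m: "f x \<in> f ` S" "f y \<in> f ` S" using assms by auto
  have "f x > 0 \<longleftrightarrow> f y > 0"
    using connectedD_interval[OF c m(1) m(2), of 0] connectedD_interval[OF c m(2) m(1), of 0] 0 m
    by (meson less_imp_le linorder_not_le)
  then show ?thesis using assms by (auto simp: sgn_real_def)
qed

text \<open>The classes are the single points of \<open>R\<close> and the components of its
  complement. The disjunct \<open>x = y\<close> covers the points of \<open>R\<close>, whose
  degenerate interval meets \<open>R\<close>.\<close>

definition same_cell :: "real set \<Rightarrow> real \<Rightarrow> real \<Rightarrow> bool" where
  "same_cell R x y \<longleftrightarrow> x = y \<or> {min x y..max x y} \<inter> R = {}"

lemma same_cell_refl: "same_cell R x x"
  by (simp add: same_cell_def)

lemma same_cell_sym: "same_cell R x y \<Longrightarrow> same_cell R y x"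
  by (auto simp: same_cell_def min.commute max.commute)

lemma same_cell_trans: "same_cell R x y \<Longrightarrow> same_cell R y z \<Longrightarrow> same_cell R x z"
  unfolding same_cell_def
proof (elim disjE)
  assume *: "{min x y..max x y} \<inter> R = {}" "{min y z..max y z} \<inter> R = {}"
  have "{min x z..max x z} \<subseteq> {min x y..max x y} \<union> {min y z..max y z}"
    by (auto simp: min_def max_def)
  with * show "x = z \<or> {min x z..max x z} \<inter> R = {}" by blast
qed auto

lemma same_cellI:
  assumes "{a..b} \<inter> R = {}" "x \<in> {a..b}" "y \<in> {a..b}"
  shows "same_cell R x y"
proof -
  have "{min x y..max x y} \<subseteq> {a..b}" using assms(2,3) by auto
  then show ?thesis using assms(1) unfolding same_cell_def by blast
qed

lemma same_cell_fixed: "same_cell R x y \<Longrightarrow> x \<in> R \<Longrightarrow> y = x"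
  unfolding same_cell_def by (metis disjoint_iff atLeastAtMost_iff max.cobounded1 min.cobounded1)

text \<open>Piecewise linear: slope \<open>k\<close> from \<open>\<alpha>\<close> to
  \<open>u\<close>, slope \<open>l\<close> from \<open>u\<close> to \<open>\<beta>\<close>, the
  identity elsewhere. It slides one root onto another without disturbing anything outside the
  interval.\<close>

lemma exists_bump:
  fixes \<alpha> \<beta> u w :: real
  assumes "\<alpha> < u" "u < \<beta>" "\<alpha> < w" "w < \<beta>"
  obtains \<psi> where "strict_mono \<psi>" "surj \<psi>" "\<psi> u = w" "\<And>x. x \<notin> {\<alpha><..<\<beta>} \<Longrightarrow> \<psi> x = x"
    "\<And>x. x \<in> {\<alpha><..<\<beta>} \<Longrightarrow> \<psi> x \<in> {\<alpha><..<\<beta>}"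
proof -
  define k where "k = (w - \<alpha>) / (u - \<alpha>)"
  define l where "l = (\<beta> - w) / (\<beta> - u)"
  have k: "k > 0" "k * (u - \<alpha>) = w - \<alpha>" and l: "l > 0" "l * (\<beta> - u) = \<beta> - w"
    using assms by (auto simp: k_def l_def)
  define \<psi> where "\<psi> x = (if x \<le> \<alpha> then x else if x \<le> u then \<alpha> + k * (x - \<alpha>)
      else if x < \<beta> then \<beta> - l * (\<beta> - x) else x)" for x
  have rng1: "\<alpha> < \<alpha> + k * (x - \<alpha>) \<and> \<alpha> + k * (x - \<alpha>) \<le> w" if "\<alpha> < x" "x \<le> u" for x
    using k that mult_left_mono[of "x - \<alpha>" "u - \<alpha>" k] by auto
  have rng2: "w < \<beta> - l * (\<beta> - x) \<and> \<beta> - l * (\<beta> - x) < \<beta>" if "u < x" "x < \<beta>" for x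
    using l that mult_strict_left_mono[of "\<beta> - x" "\<beta> - u" l] by auto
  have rng3: "z < \<alpha> + k * (x - \<alpha>)" if "\<alpha> < x" "x \<le> u" "z \<le> \<alpha>" for x z
    using rng1[of x] that by linarith
  have rng4: "\<beta> - l * (\<beta> - x) < z" if "u < x" "x < \<beta>" "\<beta> \<le> z" for x z
    using rng2[of x] that by linarith
  have 1: "strict_mono \<psi>"
  proof (rule strict_monoI)
    fix x y :: real assume "x < y"
    then show "\<psi> x < \<psi> y"
      using rng1[of x] rng1[of y] rng2[of x] rng2[of y] rng3[of y x] rng4[of x y] assms
        mult_strict_left_mono[of "x - \<alpha>" "y - \<alpha>" k] mult_strict_left_mono[of "\<beta> - y" "\<beta> - x" l] k(1) l(1)
      unfolding \<psi>_def by (auto split: if_splits)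
  qed
  have 2: "surj \<psi>"
  proof (rule surjI)
    fix y
    define x where "x = (if y \<le> \<alpha> then y else if y \<le> w then \<alpha> + (y - \<alpha>) / k
      else if y < \<beta> then \<beta> - (\<beta> - y) / l else y)"
    have a: "(y - \<alpha>) / k \<le> u - \<alpha>" if "y \<le> w"
      using that k assms by (simp add: divide_le_eq mult.commute)
    have b: "(\<beta> - y) / l < \<beta> - u" if "w < y"
      using that l assms by (simp add: divide_less_eq mult.commute)
    have "\<psi> x = y"
      using a b k(1) l(1) assms unfolding \<psi>_def x_def
      by (auto split: if_splits simp: not_le not_less zero_less_divide_iff)
    then show "\<psi> ((\<lambda>y. if y \<le> \<alpha> then y else if y \<le> w then \<alpha> + (y - \<alpha>) / k
      else if y < \<beta> then \<beta> - (\<beta> - y) / l else y) y) = y" by (simp add: x_def)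
  qed
  have "\<psi> u = w" "\<And>x. x \<notin> {\<alpha><..<\<beta>} \<Longrightarrow> \<psi> x = x"
    using assms k by (auto simp: \<psi>_def)
  moreover have "\<And>x. x \<in> {\<alpha><..<\<beta>} \<Longrightarrow> \<psi> x \<in> {\<alpha><..<\<beta>}"
  proof -
    fix x assume "x \<in> {\<alpha><..<\<beta>}"
    then show "\<psi> x \<in> {\<alpha><..<\<beta>}"
      using rng1[of x] rng2[of x] assms unfolding \<psi>_def by (cases "x \<le> u") auto
  qed
  ultimately show ?thesis using that 1 2 by blast
qed

text \<open>The factor \<open>\<sigma>\<close> records the common direction. The intervals are
  closed although only their interiors avoid \<open>R\<close>, so that values inside a cell can be
  compared with those at the points of \<open>R\<close> bounding it.\<close>

definition comonotone :: "real set \<Rightarrow> (real \<Rightarrow> real) \<Rightarrow> (real \<Rightarrow> real) \<Rightarrow> bool" where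
  "comonotone R p q \<longleftrightarrow> (\<forall>a b. a < b \<longrightarrow> {a<..<b} \<inter> R = {} \<longrightarrow>
     (\<exists>\<sigma>. \<sigma> \<noteq> 0 \<and> strict_mono_on {a..b} (\<lambda>x. \<sigma> * p x) \<and> strict_mono_on {a..b} (\<lambda>x. \<sigma> * q x)))"

text \<open>Absolute values tend to infinity at both ends of the line. In an unbounded cell this
  replaces the knowledge of a sign at an end point.\<close>

definition unbounded_fun :: "(real \<Rightarrow> real) \<Rightarrow> bool" where
  "unbounded_fun q \<longleftrightarrow> (\<forall>B. \<exists>K. \<forall>x. \<bar>x\<bar> \<ge> K \<longrightarrow> \<bar>q x\<bar> > B)"

lemma comonotone_sym: "comonotone R p q \<Longrightarrow> comonotone R q p"
  unfolding comonotone_def by blast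

lemma comonotone_neg: "comonotone R p q \<Longrightarrow> comonotone R (\<lambda>x. - p x) (\<lambda>x. - q x)"
  unfolding comonotone_def
proof (intro allI impI, goal_cases)
  case (1 a b)
  then obtain \<sigma> where "\<sigma> \<noteq> 0" "strict_mono_on {a..b} (\<lambda>x. \<sigma> * p x)" "strict_mono_on {a..b} (\<lambda>x. \<sigma> * q x)"
    by blast
  then show ?case by (intro exI[of _ "-\<sigma>"]) simp
qed

lemma comonotone_reflect:
  assumes "comonotone R p q"
  shows "comonotone (uminus ` R) (\<lambda>x. p (- x)) (\<lambda>x. q (- x))"
  unfolding comonotone_def
proof (intro allI impI)
  fix a b :: real assume "a < b" and ab: "{a<..<b} \<inter> uminus ` R = {}"
  have "{- b<..<- a} \<inter> R = {}"
  proof (rule ccontr)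
    assume "{- b<..<- a} \<inter> R \<noteq> {}"
    then obtain c where "c \<in> R" "- b < c" "c < - a" by auto
    then have "- c \<in> {a<..<b} \<inter> uminus ` R" by auto
    with ab show False by blast
  qed
  then obtain \<sigma> where "\<sigma> \<noteq> 0" and *: "strict_mono_on {-b..-a} (\<lambda>x. \<sigma> * p x)" "strict_mono_on {-b..-a} (\<lambda>x. \<sigma> * q x)"
    using assms \<open>a < b\<close> unfolding comonotone_def by (metis neg_less_iff_less)
  show "\<exists>\<sigma>. \<sigma> \<noteq> 0 \<and> strict_mono_on {a..b} (\<lambda>x. \<sigma> * p (- x)) \<and> strict_mono_on {a..b} (\<lambda>x. \<sigma> * q (- x))"
  proof (intro exI[of _ "-\<sigma>"] conjI)
    show "- \<sigma> \<noteq> 0" using \<open>\<sigma> \<noteq> 0\<close> by simp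
  qed (use * in \<open>auto simp: strict_mono_on_def\<close>)
qed

lemma comonotone_less_iff:
  assumes "comonotone R p q" "a \<le> x" "x < y" "y \<le> b" "{a<..<b} \<inter> R = {}"
    "a \<le> u" "u < v" "v \<le> b"
  shows "p x < p y \<longleftrightarrow> q u < q v" "p x < p y \<longleftrightarrow> p u < p v" "p x \<noteq> p y"
proof -
  obtain \<sigma> where s: "\<sigma> \<noteq> 0" "strict_mono_on {a..b} (\<lambda>x. \<sigma> * p x)" "strict_mono_on {a..b} (\<lambda>x. \<sigma> * q x)"
    using assms unfolding comonotone_def by (meson le_less_trans less_le_trans)
  have 1: "\<sigma> * p x < \<sigma> * p y" "\<sigma> * q u < \<sigma> * q v" "\<sigma> * p u < \<sigma> * p v"
    using s assms by (auto simp: strict_mono_on_def)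
  then show "p x < p y \<longleftrightarrow> q u < q v" "p x < p y \<longleftrightarrow> p u < p v" "p x \<noteq> p y"
    by (auto simp: mult_less_cancel_left)
qed

text \<open>To the right of \<open>x\<close> both functions increase up to the next point
  \<open>b\<close> of \<open>R\<close>. There \<open>p b > p x >= 0\<close>, hence
  \<open>q b > 0\<close> by the agreement of signs, and \<open>q\<close> has a root in between. If
  no such \<open>b\<close> exists, \<open>q\<close> increases forever and becomes positive because
  it is unbounded.\<close>

lemma root_right:
  assumes fin: "finite R" and cont: "continuous_on UNIV q" and unb: "unbounded_fun q"
    and co: "comonotone R p q" and sg: "\<forall>x\<in>R. sgn (p x) = sgn (q x)"
    and x: "p x \<ge> 0" "q x < 0" and y: "x < y" "{x..y} \<inter> R = {}" "p x < p y"
  shows "\<exists>r>x. q r = 0 \<and> {x..r} \<inter> R = {}"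
proof (cases "R \<inter> {x<..} = {}")
  case False
  define b where "b = Min (R \<inter> {x<..})"
  have b: "b \<in> R" "x < b" "\<And>c. c \<in> R \<Longrightarrow> x < c \<Longrightarrow> b \<le> c"
    using fin False Min_in[of "R \<inter> {x<..}"] by (auto simp: b_def)
  have "y < b" using y b by (metis disjoint_iff atLeastAtMost_iff linorder_not_le less_imp_le)
  have e: "{x<..<b} \<inter> R = {}" using b(3) by (force simp: not_less)
  have "p x < p b" using comonotone_less_iff(2)[OF co, of x x y b x b] y \<open>y < b\<close> e by auto
  then have "q b > 0" using sg b(1) x(1) by (metis le_less_trans sgn_greater)
  then obtain r where r: "x \<le> r" "r \<le> b" "q r = 0"
    using IVT'[of q x 0 b] x b cont continuous_on_subset by (metis less_imp_le subset_UNIV)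
  then have "x < r" "r < b" using x \<open>q b > 0\<close> by (auto simp: less_le)
  moreover have "x \<notin> R" using y(1,2) by (auto simp: disjoint_iff)
  then have "{x..r} \<inter> R = {}" using \<open>r < b\<close> e by (force simp: less_le)
  ultimately show ?thesis using r by blast
next
  case True
  obtain K where K: "\<And>z. \<bar>z\<bar> \<ge> K \<Longrightarrow> \<bar>q z\<bar> > \<bar>q x\<bar>"
    using unb unfolding unbounded_fun_def by blast
  define z where "z = max (x+1) (max y \<bar>K\<bar>)"
  have z: "x < z" "y \<le> z" "\<bar>z\<bar> \<ge> K" by (auto simp: z_def)
  have "{x<..<z} \<inter> R = {}" using True by auto
  then have "q x < q z" using comonotone_less_iff(1)[OF co, of x x y z x z] y z by auto
  with K[OF z(3)] x have "q z > 0" by linarith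
  then obtain r where r: "x \<le> r" "r \<le> z" "q r = 0"
    using IVT'[of q x 0 z] x z cont continuous_on_subset by (metis less_imp_le subset_UNIV)
  then have "x < r" using x by (auto simp: less_le)
  moreover have "x \<notin> R" using y(1,2) by (auto simp: disjoint_iff)
  then have "{x..r} \<inter> R = {}" using True by (force simp: less_le)
  ultimately show ?thesis using r by blast
qed

lemma finite_avoid_nbhd:
  fixes R :: "real set"
  assumes "finite R" "{a..b} \<inter> R = {}" "a \<le> b"
  obtains d where "d > 0" "{a-d..b+d} \<inter> R = {}"
proof -
  obtain d where d: "d > 0" "\<And>x y. x \<in> {a..b} \<Longrightarrow> y \<in> R \<Longrightarrow> d \<le> dist x y"
    using separate_compact_closed[of "{a..b}" R] assms finite_imp_closed[of R] by blast
  have "{a-d/2..b+d/2} \<inter> R = {}"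
  proof (rule ccontr)
    assume "{a-d/2..b+d/2} \<inter> R \<noteq> {}"
    then obtain c where c: "c \<in> R" "a-d/2 \<le> c" "c \<le> b+d/2" by auto
    then have "c < a \<or> c > b" using assms(2) by (meson atLeastAtMost_iff disjoint_iff not_less)
    then show False using d(2)[of a c] d(2)[of b c] c assms(3) d(1) by (auto simp: dist_real_def)
  qed
  then show ?thesis using that[of "d/2"] d(1) by simp
qed

text \<open>Where the signs disagree, \<open>x\<close> is not in \<open>R\<close>, so both functions
  are strictly monotone around \<open>x\<close>. The root of \<open>q\<close> is found in the
  direction in which \<open>p\<close> grows; growth to the left is reduced to growth to the right by
  reflection.\<close>

lemma root_in_cell_aux:
  assumes fin: "finite R" and cont: "continuous_on UNIV q" and unb: "unbounded_fun q"
    and co: "comonotone R p q" and sg: "\<forall>x\<in>R. sgn (p x) = sgn (q x)"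
    and x: "p x \<ge> 0" "q x < 0"
  shows "\<exists>r. q r = 0 \<and> same_cell R x r"
proof -
  have "x \<notin> R" using sg x by (metis linorder_not_le sgn_less)
  then obtain d where d: "d > 0" "{x-d..x+d} \<inter> R = {}"
    using finite_avoid_nbhd[OF fin, of x x] by auto
  have e: "{x-d<..<x+d} \<inter> R = {}"
    using d(2) greaterThanLessThan_subseteq_atLeastAtMost_iff[of "x-d" "x+d" "x-d" "x+d"] by blast
  show ?thesis
  proof (cases "p x < p (x+d)")
    case True
    then have "\<exists>r>x. q r = 0 \<and> {x..r} \<inter> R = {}"
      using d by (intro root_right[OF fin cont unb co sg x, of "x+d"]) (auto simp: disjoint_iff)
    then obtain r where "r > x" "q r = 0" "{x..r} \<inter> R = {}" by blast
    then show ?thesis using same_cellI[of x r R x r] by auto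
  next
    case False
    have "\<not> p (x-d) < p x" "p (x-d) \<noteq> p x"
      using False comonotone_less_iff(2,3)[OF co, of "x-d" "x-d" x "x+d" x "x+d"] d e by auto
    then have *: "p x < p (x - d)" by simp
    have "\<exists>r>-x. q (-r) = 0 \<and> {-x..r} \<inter> uminus ` R = {}"
    proof (rule root_right[where p = "\<lambda>x. p (-x)" and y = "-x+d"])
      show "continuous_on UNIV (\<lambda>x. q (-x))"
        by (rule continuous_on_compose2[OF cont]) (auto intro: continuous_intros)
      show "unbounded_fun (\<lambda>x. q (-x))"
        using unb unfolding unbounded_fun_def by (metis abs_minus_cancel)
      show "{-x..-x+d} \<inter> uminus ` R = {}"
        using d by (force simp: disjoint_iff)
    qed (use fin comonotone_reflect[OF co] sg x d * in auto)
    then obtain r where r: "r > -x" "q (-r) = 0" "{-x..r} \<inter> uminus ` R = {}" by blast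
    have "{-r..x} \<inter> R = {}"
    proof (rule ccontr)
      assume "{-r..x} \<inter> R \<noteq> {}"
      then obtain c where "c \<in> R" "-r \<le> c" "c \<le> x" by auto
      then have "-c \<in> {-x..r} \<inter> uminus ` R" by auto
      then show False using r(3) by blast
    qed
    then show ?thesis using r by (intro exI[of _ "-r"]) (auto simp: same_cell_def min_def max_def)
  qed
qed

lemma root_in_cell:
  assumes fin: "finite R" and cont: "continuous_on UNIV q" and unb: "unbounded_fun q"
    and co: "comonotone R p q" and sg: "\<forall>x\<in>R. sgn (p x) = sgn (q x)"
    and x: "sgn (p x) \<noteq> sgn (q x)" "q x \<noteq> 0"
  shows "\<exists>r. q r = 0 \<and> same_cell R x r"
proof (cases "q x < 0")
  case True
  then have "p x \<ge> 0" using x by (metis linorder_not_le sgn_neg)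
  with True root_in_cell_aux[OF assms(1-5)] show ?thesis by blast
next
  case False
  then have "q x > 0" "p x \<le> 0" using x by (metis linorder_neqE linorder_not_le sgn_pos)+
  then have "\<exists>r. - q r = 0 \<and> same_cell R x r"
    using comonotone_neg[OF co] sg cont unb fin
    by (intro root_in_cell_aux[where p = "\<lambda>x. - p x"])
       (auto intro: continuous_intros simp: unbounded_fun_def sgn_minus)
  then show ?thesis by simp
qed

text \<open>In particular no cell contains two roots of \<open>p\<close>, so the roots can be moved
  independently of each other.\<close>

lemma comonotone_cell_inj:
  assumes "comonotone R p q" "same_cell R x y" "p x = p y"
  shows "x = y"
proof (rule ccontr)
  assume "x \<noteq> y"
  then have e: "{min x y<..<max x y} \<inter> R = {}"
    using assms(2) greaterThanLessThan_subseteq_atLeastAtMost_iff[of "min x y" "max x y" "min x y" "max x y"]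
    unfolding same_cell_def by blast
  show False
    using comonotone_less_iff(3)[OF assms(1) _ _ _ e, of "min x y" "max x y" "min x y" "max x y"] \<open>x \<noteq> y\<close> assms(3)
    by (cases "x \<le> y") (auto simp: min_def max_def)
qed

text \<open>Roots are treated one at a time. \<open>root_in_cell\<close> supplies a root
  \<open>s\<close> of \<open>q\<close> in the cell of \<open>r\<close>, and a bump supported inside
  that cell takes \<open>\<psi> r\<close> to \<open>s\<close>. The roots treated before lie in other
  cells and stay where they are.\<close>

lemma adjust_roots:
  assumes fin: "finite R" and cont: "continuous_on UNIV q" and unb: "unbounded_fun q"
    and co: "comonotone R p q" and sg: "\<forall>x\<in>R. sgn (p x) = sgn (q x)"
    and D: "finite D" "\<forall>r\<in>D. p r = 0"
  shows "\<exists>\<psi>. strict_mono \<psi> \<and> surj \<psi> \<and> (\<forall>x. same_cell R x (\<psi> x)) \<and> (\<forall>r\<in>D. q (\<psi> r) = 0)"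
  using D
proof (induction D rule: finite_induct)
  case empty
  show ?case by (rule exI[of _ id]) (auto simp: same_cell_refl strict_mono_def)
next
  case (insert r D)
  then obtain \<psi> where \<psi>: "strict_mono \<psi>" "surj \<psi>" "\<And>x. same_cell R x (\<psi> x)" "\<And>r. r \<in> D \<Longrightarrow> q (\<psi> r) = 0"
    by auto
  have pr: "p r = 0" using insert by auto
  obtain s where s: "q s = 0" "same_cell R r s"
    using root_in_cell[OF fin cont unb co sg, of r] pr same_cell_refl by (metis sgn_0_0)
  have us: "same_cell R (\<psi> r) s" using s(2) \<psi>(3) same_cell_sym same_cell_trans by blast
  show ?case
  proof (cases "\<psi> r = s")
    case True
    with \<psi> s show ?thesis by (intro exI[of _ \<psi>]) auto
  next
    case False
    then have "{min (\<psi> r) s..max (\<psi> r) s} \<inter> R = {}" using us by (simp add: same_cell_def)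
    then obtain d where d: "d > 0" "{min (\<psi> r) s-d..max (\<psi> r) s+d} \<inter> R = {}"
      using finite_avoid_nbhd[OF fin, of "min (\<psi> r) s" "max (\<psi> r) s"] by (metis max.coboundedI1 min.cobounded1)
    define \<alpha> \<beta> where "\<alpha> = min (\<psi> r) s-d" and "\<beta> = max (\<psi> r) s+d"
    have ab: "\<alpha> < \<psi> r" "\<alpha> < s" "\<psi> r < \<beta>" "s < \<beta>" using d by (auto simp: \<alpha>_def \<beta>_def)
    have cell: "same_cell R x y" if "x \<in> {\<alpha><..<\<beta>}" "y \<in> {\<alpha><..<\<beta>}" for x y
      using d(2) that unfolding \<alpha>_def[symmetric] \<beta>_def[symmetric] by (intro same_cellI[of \<alpha> \<beta>]) auto
    obtain \<phi> where \<phi>: "strict_mono \<phi>" "surj \<phi>" "\<phi> (\<psi> r) = s" "\<And>x. x \<notin> {\<alpha><..<\<beta>} \<Longrightarrow> \<phi> x = x"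
      "\<And>x. x \<in> {\<alpha><..<\<beta>} \<Longrightarrow> \<phi> x \<in> {\<alpha><..<\<beta>}"
      using exists_bump[OF ab(1,3,2,4)] by metis
    have phicell: "same_cell R x (\<phi> x)" for x
      using \<phi>(4,5)[of x] cell same_cell_refl by metis
    show ?thesis
    proof (intro exI[of _ "\<phi> \<circ> \<psi>"] conjI allI ballI)
      show "strict_mono (\<phi> \<circ> \<psi>)" using \<phi>(1) \<psi>(1) by (simp add: strict_mono_o)
      show "surj (\<phi> \<circ> \<psi>)" using \<psi>(2) \<phi>(2) by (rule comp_surj)
      show "same_cell R x ((\<phi> \<circ> \<psi>) x)" for x
        using \<psi>(3) phicell same_cell_trans by (metis comp_apply)
      fix t assume "t \<in> insert r D"
      show "q ((\<phi> \<circ> \<psi>) t) = 0"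
      proof (cases "t = r")
        case True
        then show ?thesis using \<phi>(3) s by simp
      next
        case False
        then have "t \<in> D" using \<open>t \<in> insert r D\<close> by auto
        have "\<psi> t \<notin> {\<alpha><..<\<beta>}"
        proof
          assume "\<psi> t \<in> {\<alpha><..<\<beta>}"
          then have "same_cell R (\<psi> t) (\<psi> r)" using cell ab by auto
          then have "same_cell R t r" using \<psi>(3) same_cell_sym same_cell_trans by metis
          then show False using comonotone_cell_inj[OF co] pr insert.prems \<open>t \<in> D\<close> False by auto
        qed
        then show ?thesis using \<phi>(4) \<psi>(4) \<open>t \<in> D\<close> by simp
      qed
    qed
  qed
qed

text \<open>Inside a cell the sign is decided by the common direction of monotonicity and by the
  side of the root on which the point lies.\<close>

lemma comonotone_sgn:
  assumes co: "comonotone R p q" and "same_cell R x r" "same_cell R r t" "x < r \<longleftrightarrow> y < t" "x = r \<longleftrightarrow> y = t"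
    "same_cell R x y" "p r = 0" "q t = 0"
  shows "sgn (p x) = sgn (q y)"
proof (cases "x = r")
  case False
  define a b where "a = min (min x r) (min y t)" and "b = max (max x r) (max y t)"
  have d1: "{min x r..max x r} \<inter> R = {}" using assms(2) False by (simp add: same_cell_def)
  then have "r \<notin> R" "x \<notin> R" using assms(2) False by (auto dest: same_cell_fixed same_cell_sym)
  then have d2: "{min r t..max r t} \<inter> R = {}" "{min x y..max x y} \<inter> R = {}"
    using assms(3,6) by (auto simp: same_cell_def)
  have "{a<..<b} \<subseteq> {min x r..max x r} \<union> {min r t..max r t} \<union> {min x y..max x y}"
    unfolding a_def b_def by (auto simp: min_less_iff_disj less_max_iff_disj min_le_iff_disj le_max_iff_disj)
  with d1 d2 have "{a<..<b} \<inter> R = {}" by blast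
  moreover have ab: "a < b" using False by (auto simp: a_def b_def)
  ultimately obtain \<sigma> where s: "\<sigma> \<noteq> 0" "strict_mono_on {a..b} (\<lambda>x. \<sigma> * p x)" "strict_mono_on {a..b} (\<lambda>x. \<sigma> * q x)"
    using co unfolding comonotone_def by meson
  have m: "x \<in> {a..b}" "r \<in> {a..b}" "y \<in> {a..b}" "t \<in> {a..b}" by (auto simp: a_def b_def)
  have "sgn (\<sigma> * p x) = sgn (\<sigma> * q y)"
  proof (cases "x < r")
    case True
    then have "\<sigma> * p x < 0" "\<sigma> * q y < 0"
      using strict_mono_onD[OF s(2) m(1,2)] strict_mono_onD[OF s(3) m(3,4)] assms by auto
    then show ?thesis by (metis sgn_neg)
  next
    case n: False
    then have "r < x" "t < y" using assms False by auto
    then have "\<sigma> * p x > 0" "\<sigma> * q y > 0"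
      using strict_mono_onD[OF s(2) m(2,1)] strict_mono_onD[OF s(3) m(4,3)] assms by auto
    then show ?thesis by (metis sgn_pos)
  qed
  then show ?thesis using s(1) by (auto simp: sgn_mult sgn_eq_0_iff)
qed (use assms in simp)

text \<open>In a cell with a root of \<open>p\<close>, that root goes to a root of \<open>q\<close>
  and \<open>comonotone_sgn\<close> applies. In a cell without one, \<open>q\<close> has no root
  either, since \<open>root_in_cell\<close> with the roles exchanged would produce a root of
  \<open>p\<close>; so \<open>q\<close> keeps the sign of \<open>p\<close> throughout the
  cell.\<close>

lemma adjust_signs:
  assumes fin: "finite R" and contp: "continuous_on UNIV p" and contq: "continuous_on UNIV q"
    and unbp: "unbounded_fun p" and unbq: "unbounded_fun q"
    and co: "comonotone R p q" and sg: "\<forall>x\<in>R. sgn (p x) = sgn (q x)" and roots: "finite {x. p x = 0}"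
  shows "\<exists>\<psi>. strict_mono \<psi> \<and> surj \<psi> \<and> (\<forall>x. same_cell R x (\<psi> x)) \<and> (\<forall>x. sgn (p x) = sgn (q (\<psi> x)))"
proof -
  obtain \<psi> where \<psi>: "strict_mono \<psi>" "surj \<psi>" "\<And>x. same_cell R x (\<psi> x)" "\<And>r. p r = 0 \<Longrightarrow> q (\<psi> r) = 0"
    using adjust_roots[OF fin contq unbq co sg roots] by auto
  have key: "sgn (p x) = sgn (q (\<psi> x))" if "p r = 0" "same_cell R x r" for x r
    using that \<psi> same_cell_refl strict_mono_less[OF \<psi>(1)] strict_mono_eq[OF \<psi>(1)]
    by (intro comonotone_sgn[OF co, of x r "\<psi> r" "\<psi> x"]) auto
  have "sgn (p x) = sgn (q (\<psi> x))" for x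
  proof (rule ccontr)
    assume ne: "sgn (p x) \<noteq> sgn (q (\<psi> x))"
    have px: "p x \<noteq> 0" using ne \<psi>(4) by auto
    have nr: "\<nexists>r. p r = 0 \<and> same_cell R x r" using key ne by blast
    have pq: "sgn (p x) = sgn (q x)"
      using root_in_cell[OF fin contp unbp comonotone_sym[OF co], of x] sg px nr by metis
    have "x \<noteq> \<psi> x" using pq ne by auto
    obtain z where z: "same_cell R x z" "q z = 0"
    proof -
      have "\<exists>z\<in>{min x (\<psi> x)..max x (\<psi> x)}. q z = 0"
      proof (rule ccontr)
        assume "\<not> ?thesis"
        then have "sgn (q x) = sgn (q (\<psi> x))"
          by (intro sgn_const_of_no_root[of "{min x (\<psi> x)..max x (\<psi> x)}"] continuous_on_subset[OF contq])
             (auto simp: Bex_def)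
        with pq ne show False by simp
      qed
      then obtain z where z: "min x (\<psi> x) \<le> z" "z \<le> max x (\<psi> x)" "q z = 0" by auto
      have "{min x (\<psi> x)..max x (\<psi> x)} \<inter> R = {}" using \<psi>(3)[of x] \<open>x \<noteq> \<psi> x\<close> by (simp add: same_cell_def)
      then have "same_cell R x z" using z by (intro same_cellI) auto
      then show ?thesis using that z by blast
    qed
    have "p z \<noteq> 0" using nr z by blast
    then obtain r where "p r = 0" "same_cell R z r"
      using root_in_cell[OF fin contp unbp comonotone_sym[OF co], of z] sg z by (metis sgn_0_0)
    then show False using nr z same_cell_trans by blast
  qed
  with \<psi> show ?thesis by blast
qed

subsection \<open>Polynomials with coefficients in a ring of functions\<close>

text \<open>The leading coefficient \<open>a d\<close> may vanish at some parameters \<open>y\<close>. Truncating a polynomial means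
  reading the same coefficient sequence at a smaller degree.\<close>

definition ev :: "nat \<Rightarrow> (nat \<Rightarrow> 'y \<Rightarrow> real) \<Rightarrow> 'y \<Rightarrow> real \<Rightarrow> real" where
  "ev d a y x = (\<Sum>j\<le>d. a j y * x ^ j)"

definition function_algebra :: "('y \<Rightarrow> real) set \<Rightarrow> bool" where
  "function_algebra A \<longleftrightarrow> (\<forall>c. (\<lambda>_. c) \<in> A) \<and> (\<forall>u\<in>A. \<forall>w\<in>A. (\<lambda>y. u y + w y) \<in> A \<and> (\<lambda>y. u y * w y) \<in> A)"

lemma function_algebraD:
  assumes "function_algebra A"
  shows "(\<lambda>_. c) \<in> A" "u \<in> A \<Longrightarrow> w \<in> A \<Longrightarrow> (\<lambda>y. u y + w y) \<in> A"
    "u \<in> A \<Longrightarrow> w \<in> A \<Longrightarrow> (\<lambda>y. u y * w y) \<in> A" "u \<in> A \<Longrightarrow> w \<in> A \<Longrightarrow> (\<lambda>y. u y - w y) \<in> A"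
proof -
  have *: "(\<lambda>_. c) \<in> A" "u \<in> A \<Longrightarrow> w \<in> A \<Longrightarrow> (\<lambda>y. u y + w y) \<in> A"
    "u \<in> A \<Longrightarrow> w \<in> A \<Longrightarrow> (\<lambda>y. u y * w y) \<in> A" for c u w
    using assms by (auto simp: function_algebra_def)
  show "(\<lambda>_. c) \<in> A" "u \<in> A \<Longrightarrow> w \<in> A \<Longrightarrow> (\<lambda>y. u y + w y) \<in> A"
    "u \<in> A \<Longrightarrow> w \<in> A \<Longrightarrow> (\<lambda>y. u y * w y) \<in> A" by (fact *)+
  show "u \<in> A \<Longrightarrow> w \<in> A \<Longrightarrow> (\<lambda>y. u y - w y) \<in> A"
    using *(2)[of u "\<lambda>y. -1 * w y"] *(3)[OF *(1)[of "-1"], of w] by auto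
qed

lemma ev_Suc: "ev (Suc d) a y x = ev d a y x + a (Suc d) y * x ^ Suc d"
  by (simp add: ev_def)

lemma ev_split: "ev (Suc d) a y x = a 0 y + x * ev d (\<lambda>j. a (Suc j)) y x"
  unfolding ev_def by (subst sum.atMost_Suc_shift) (simp add: sum_distrib_left algebra_simps)

lemma ev_shift:
  assumes "k \<le> m"
  shows "(\<Sum>j\<le>m. (if k \<le> j then b (j - k) y else 0) * x ^ j) = x ^ k * ev (m - k) b y x"
  using assms
proof (induction k arbitrary: m)
  case 0
  then show ?case by (simp add: ev_def)
next
  case (Suc k)
  then obtain m' where m: "m = Suc m'" by (cases m) auto
  have "(\<Sum>j\<le>m. (if Suc k \<le> j then b (j - Suc k) y else 0) * x ^ j)
     = (\<Sum>j\<le>m'. (if k \<le> j then b (j - k) y else 0) * x ^ j) * x"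
    unfolding m by (subst sum.atMost_Suc_shift) (simp add: sum_distrib_left mult_ac cong: if_cong)
  then show ?case using Suc m by simp
qed

text \<open>The formal polynomial \<open>r\<close>, read at degree \<open>k\<close>, is a pseudo-remainder of \<open>a\<close> (degree \<open>m\<close>)
  modulo \<open>b\<close> (degree \<open>k + 1\<close>); only its values at the roots of \<open>b\<close> matter.\<close>

definition prem_of ::
  "nat \<Rightarrow> (nat \<Rightarrow> 'y \<Rightarrow> real) \<Rightarrow> nat \<Rightarrow> (nat \<Rightarrow> 'y \<Rightarrow> real) \<Rightarrow> (nat \<Rightarrow> 'y \<Rightarrow> real) \<Rightarrow> bool" where
  "prem_of m a k b r \<longleftrightarrow> (\<exists>N. \<forall>y x. ev (Suc k) b y x = 0 \<longrightarrow> ev k r y x = b (Suc k) y ^ N * ev m a y x)"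

text \<open>Pseudo-division: each reduction of the degree of \<open>a\<close> costs one factor
  \<open>b (Suc k)\<close>, and \<open>N\<close> counts these factors. No division by a coefficient
  occurs, so the remainder stays over \<open>A\<close>.\<close>

lemma pseudo_remainder:
  assumes A: "function_algebra A" and b: "\<And>j. b j \<in> A" and a: "\<And>j. a j \<in> A"
  shows "\<exists>r. (\<forall>j. r j \<in> A) \<and> prem_of m a k b r"
  using a
proof (induction m arbitrary: a)
  case 0
  \<comment> \<open>The result is read at degree \<open>k\<close>, possibly larger than the degree
    of \<open>a\<close>, so the coefficients beyond the latter are cut off.\<close>
  define r where "r j = (if j = 0 then a 0 else (\<lambda>_. 0))" for j :: nat
  have "ev k r y x = ev 0 a y x" for y x
    unfolding ev_def r_def by (simp add: if_distrib[of "\<lambda>f. f _"] if_distrib[of "\<lambda>f. f * _"] sum.delta cong: if_cong)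
  then have "prem_of 0 a k b r" unfolding prem_of_def by (intro exI[of _ 0]) simp
  moreover have "\<forall>j. r j \<in> A" using 0 function_algebraD(1)[OF A] by (auto simp: r_def)
  ultimately show ?case by blast
next
  case (Suc m)
  show ?case
  proof (cases "m < k")
    case True
    define r where "r j = (if j \<le> Suc m then a j else (\<lambda>_. 0))" for j
    have "ev k r y x = ev (Suc m) a y x" for y x
      unfolding ev_def r_def using True
      by (intro sum.mono_neutral_cong_right) auto
    then have "prem_of (Suc m) a k b r" unfolding prem_of_def by (intro exI[of _ 0]) simp
    moreover have "\<forall>j. r j \<in> A" using Suc.prems function_algebraD(1)[OF A] by (auto simp: r_def)
    ultimately show ?thesis by blast
  next
    case False
    then have k: "k \<le> m" by simp
    \<comment> \<open>The multiple of \<open>b\<close>, shifted by \<open>m - k\<close>, cancels the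
      coefficient at \<open>Suc m\<close>. At a root of \<open>b\<close> only the multiple of
      \<open>a\<close> remains.\<close>
    define c where "c j = (\<lambda>y. b (Suc k) y * a j y - a (Suc m) y * (if m - k \<le> j then b (j - (m - k)) y else 0))" for j
    have "c j \<in> A" for j
      unfolding c_def using b Suc.prems function_algebraD[OF A] by (cases "m - k \<le> j") auto
    from Suc.IH[of c, OF this] obtain r N where r: "\<And>j. r j \<in> A"
      "\<And>y x. ev (Suc k) b y x = 0 \<Longrightarrow> ev k r y x = b (Suc k) y ^ N * ev m c y x"
      unfolding prem_of_def by blast
    have ec: "ev m c y x = b (Suc k) y * ev (Suc m) a y x - a (Suc m) y * (x ^ (m-k) * ev (Suc k) b y x)" for y x
    proof -
      have c0: "c (Suc m) y = 0" using k by (simp add: c_def Suc_diff_le)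
      have "(\<Sum>j\<le>Suc m. c j y * x ^ j) = b (Suc k) y * ev (Suc m) a y x
         - a (Suc m) y * (\<Sum>j\<le>Suc m. (if m-k \<le> j then b (j - (m - k)) y else 0) * x ^ j)"
        by (simp only: c_def ev_def sum_distrib_left left_diff_distrib sum_subtractf mult.assoc)
      also have "\<dots> = b (Suc k) y * ev (Suc m) a y x - a (Suc m) y * (x ^ (m-k) * ev (Suc k) b y x)"
        using ev_shift[of "m-k" "Suc m" b y x] k by (simp add: Suc_diff_le)
      also have "(\<Sum>j\<le>Suc m. c j y * x ^ j) = ev m c y x"
        using c0 by (simp add: ev_def)
      finally show ?thesis .
    qed
    have "prem_of (Suc m) a k b r" unfolding prem_of_def
      by (intro exI[of _ "Suc N"]) (simp add: r(2) ec mult.assoc mult.left_commute)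
    then show ?thesis using r(1) by blast
  qed
qed

section \<open>Closure under derivatives and pseudo-remainders, and matching of sign tables\<close>

definition derivc :: "(nat \<Rightarrow> 'y \<Rightarrow> real) \<Rightarrow> nat \<Rightarrow> 'y \<Rightarrow> real" where
  "derivc a j y = real (Suc j) * a (Suc j) y"

lemma derivc_in: "function_algebra A \<Longrightarrow> (\<And>j. a j \<in> A) \<Longrightarrow> derivc a j \<in> A"
  using function_algebraD(3)[OF _ function_algebraD(1), of A "a (Suc j)" "real (Suc j)"] by (simp add: derivc_def[abs_def])

lemma ev_derivative: "(ev (Suc d) a y has_real_derivative ev d (derivc a) y x) (at x)"
proof -
  have "((\<lambda>x. \<Sum>j\<le>Suc d. a j y * x ^ j) has_real_derivative (\<Sum>j\<le>Suc d. a j y * (real j * x ^ (j - 1)))) (at x)"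
    using DERIV_pow by (intro DERIV_sum DERIV_cmult) simp
  also have "(\<Sum>j\<le>Suc d. a j y * (real j * x ^ (j - 1))) = ev d (derivc a) y x"
    by (subst sum.atMost_Suc_shift) (simp add: ev_def derivc_def algebra_simps)
  finally show ?thesis by (simp add: ev_def[abs_def])
qed

lemma continuous_ev: "continuous_on S (ev d a y)"
  unfolding ev_def[abs_def] by (intro continuous_intros)

lemma finite_roots_ev:
  assumes "ev d a y x \<noteq> 0"
  shows "finite {x. ev d a y x = 0}"
proof -
  have "\<exists>i\<le>d. a i y \<noteq> 0" using assms by (auto simp: ev_def intro!: sum.neutral)
  then show ?thesis using polyfun_finite_roots[of "\<lambda>i. a i y" d] by (simp add: ev_def)
qed

lemma unbounded_ev:
  assumes "a (Suc d) y \<noteq> 0"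
  shows "unbounded_fun (ev (Suc d) a y)"
  unfolding unbounded_fun_def
proof
  fix B
  have "eventually (\<lambda>z. norm (\<Sum>i\<le>Suc d. a i y * z ^ i) \<ge> B + 1) at_infinity"
    using assms by (intro polyfun_extremal[of "Suc d"]) auto
  then obtain K where K: "\<And>z. norm z \<ge> K \<Longrightarrow> norm (\<Sum>i\<le>Suc d. a i y * z ^ i) \<ge> B + 1"
    by (auto simp: eventually_at_infinity)
  then show "\<exists>K. \<forall>x. \<bar>x\<bar> \<ge> K \<longrightarrow> \<bar>ev (Suc d) a y x\<bar> > B"
    unfolding ev_def real_norm_def by (meson less_add_one less_le_trans)
qed

lemma strict_mono_of_deriv:
  fixes f :: "real \<Rightarrow> real"
  assumes "\<And>x. (f has_real_derivative f' x) (at x)" "\<And>x. x \<in> {a<..<b} \<Longrightarrow> \<sigma> * f' x > 0"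
  shows "strict_mono_on {a..b} (\<lambda>x. \<sigma> * f x)"
proof (rule strict_mono_onI)
  fix r s assume rs: "r \<in> {a..b}" "s \<in> {a..b}" "r < s"
  have c: "continuous_on {r..s} (\<lambda>x. \<sigma> * f x)"
    by (intro continuous_intros continuous_at_imp_continuous_on) (use DERIV_isCont assms(1) in blast)
  show "\<sigma> * f r < \<sigma> * f s"
  proof (rule DERIV_pos_imp_increasing_open[OF rs(3) _ c])
    fix x assume "r < x" "x < s"
    then have "\<sigma> * f' x > 0" using rs by (intro assms(2)) auto
    then show "\<exists>y. ((\<lambda>x. \<sigma> * f x) has_real_derivative y) (at x) \<and> 0 < y"
      using DERIV_cmult[OF assms(1)] by blast
  qed
qed

text \<open>The finite closure behind the Cohen--Hoermander elimination: every operation applied at degree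
  \<open>e + 1\<close> lands in degree \<open>e\<close>, so the closure of a finite set stays finite.\<close>

definition closed_levels :: "nat \<Rightarrow> (nat \<Rightarrow> (nat \<Rightarrow> 'y \<Rightarrow> real) set) \<Rightarrow> bool" where
  "closed_levels d C \<longleftrightarrow> (\<forall>e<d. C (Suc e) \<subseteq> C e \<and> derivc ` C (Suc e) \<subseteq> C e \<and>
     (\<forall>a\<in>C (Suc e). \<forall>b\<in>C (Suc e). \<forall>m\<le>d. \<exists>r\<in>C e. prem_of m a e b r))"

lemma exists_closed_levels:
  assumes A: "function_algebra A" and P: "finite P" "\<forall>a\<in>P. \<forall>j. a j \<in> A"
  shows "\<exists>C. closed_levels d C \<and> C d = P \<and> (\<forall>e\<le>d. finite (C e) \<and> (\<forall>a\<in>C e. \<forall>j. a j \<in> A))"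
proof -
  \<comment> \<open>One remainder is chosen for each pair and degree, so that finitely many
    polynomials have only finitely many remainders.\<close>
  define Rem where "Rem m k a b = (SOME r. (\<forall>j. r j \<in> A) \<and> prem_of m a k b r)" for m k and a b :: "nat \<Rightarrow> 'a \<Rightarrow> real"
  have Rem: "Rem m k a b j \<in> A" "prem_of m a k b (Rem m k a b)"
    if "\<And>j. a j \<in> A" "\<And>j. b j \<in> A" for m k a b j
  proof -
    have "(\<forall>j. Rem m k a b j \<in> A) \<and> prem_of m a k b (Rem m k a b)"
      unfolding Rem_def using pseudo_remainder[of A b a m k, OF A that(2,1)] by (rule someI_ex)
    then show "Rem m k a b j \<in> A" "prem_of m a k b (Rem m k a b)" by simp_all
  qed
  define step where "step k X = X \<union> derivc ` X \<union> (\<lambda>(m,a,b). Rem m k a b) ` ({..d} \<times> X \<times> X)" for k X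
  have step: "finite (step k X)" "\<And>a j. a \<in> step k X \<Longrightarrow> a j \<in> A"
    if "finite X" "\<And>a j. a \<in> X \<Longrightarrow> a j \<in> A" for k X
  proof -
    show "finite (step k X)" using that(1) by (simp add: step_def)
    fix a j assume "a \<in> step k X"
    then show "a j \<in> A"
      unfolding step_def
    proof (elim UnE imageE)
      fix b assume "a = derivc b" "b \<in> X"
      then show ?thesis using derivc_in[OF A, of b j] that(2)[of b] by simp
    next
      fix w assume "a = (\<lambda>(m,a,b). Rem m k a b) w" "w \<in> {..d} \<times> X \<times> X"
      then obtain m b c where "b \<in> X" "c \<in> X" "a = Rem m k b c" by auto
      then show ?thesis using Rem(1)[where a = b and b = c] that(2) by simp
    qed (use that(2) in simp)
  qed
  \<comment> \<open>The recursion starts at the given set and goes down in degree: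
    \<open>G i\<close> is the level \<open>d - i\<close>.\<close>
  define G where "G = rec_nat P (\<lambda>i X. step (d - Suc i) X)"
  have G0: "G 0 = P" and GS: "\<And>i. G (Suc i) = step (d - Suc i) (G i)" by (simp_all add: G_def)
  have G: "finite (G i) \<and> (\<forall>a\<in>G i. \<forall>j. a j \<in> A)" for i
  proof (induction i)
    case (Suc i)
    then show ?case using step(1)[of "G i" "d - Suc i"] step(2)[of "G i" _ "d - Suc i"] by (simp add: GS)
  qed (use P in \<open>simp add: G0\<close>)
  define C where "C e = G (d - e)" for e
  have GC: "finite (C e)" "\<forall>a\<in>C e. \<forall>j. a j \<in> A" for e using G by (auto simp: C_def)
  have "closed_levels d C"
    unfolding closed_levels_def
  proof (intro allI impI conjI)
    fix e assume "e < d"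
    then have "d - e = Suc (d - Suc e)" "d - Suc (d - Suc e) = e" by auto
    then have C: "C e = step e (C (Suc e))" by (simp add: C_def GS)
    show "C (Suc e) \<subseteq> C e" "derivc ` C (Suc e) \<subseteq> C e" unfolding C step_def by blast+
    show "\<forall>a\<in>C (Suc e). \<forall>b\<in>C (Suc e). \<forall>m\<le>d. \<exists>r\<in>C e. prem_of m a e b r"
    proof (intro ballI allI impI)
      fix a b m assume ab: "a \<in> C (Suc e)" "b \<in> C (Suc e)" "m \<le> d"
      then have "Rem m e a b \<in> C e" unfolding C step_def by (auto intro!: image_eqI[of _ _ "(m,a,b)"])
      moreover have "prem_of m a e b (Rem m e a b)" using Rem(2)[where a = a and b = b] ab GC(2) by simp
      ultimately show "\<exists>r\<in>C e. prem_of m a e b r" by blast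
    qed
  qed
  then show ?thesis using GC G0 by (intro exI[of _ C]) (simp add: C_def)
qed

text \<open>The sign tables over \<open>y\<close> and \<open>z\<close> have the same columns in the
  same order. Keeping the order, and not only the set of columns, is what allows a further
  polynomial to be placed between the roots already matched.\<close>

definition matches ::
  "(nat \<times> (nat \<Rightarrow> 'y \<Rightarrow> real)) set \<Rightarrow> 'y \<Rightarrow> 'y \<Rightarrow> (real \<Rightarrow> real) \<Rightarrow> bool" where
  "matches F y z \<theta> \<longleftrightarrow> strict_mono \<theta> \<and> surj \<theta> \<and>
     (\<forall>(m,a)\<in>F. \<forall>x. sgn (ev m a y x) = sgn (ev m a z (\<theta> x)))"

lemma strict_mono_surj_continuous:
  fixes \<theta> :: "real \<Rightarrow> real"
  assumes "strict_mono \<theta>" "surj \<theta>"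
  shows "continuous_on UNIV \<theta>"
  using assms by (intro continuous_onI_mono) (auto simp: strict_mono_less_eq)

lemma unbounded_fun_compose:
  assumes "strict_mono \<theta>" "surj \<theta>" "unbounded_fun q"
  shows "unbounded_fun (\<lambda>x. q (\<theta> x))"
  unfolding unbounded_fun_def
proof
  fix B
  obtain K where K: "\<And>x. \<bar>x\<bar> \<ge> K \<Longrightarrow> \<bar>q x\<bar> > B" using assms(3) unfolding unbounded_fun_def by blast
  obtain u v where uv: "\<theta> u = K" "\<theta> v = - K" using assms(2) by (metis surjD)
  have "\<bar>\<theta> x\<bar> \<ge> K" if "\<bar>x\<bar> \<ge> max \<bar>u\<bar> \<bar>v\<bar>" for x
  proof (cases "x \<ge> 0")
    case True
    then have "x \<ge> u" using that by auto
    then have "\<theta> x \<ge> K" using uv assms(1) by (metis strict_mono_less_eq)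
    then show ?thesis by auto
  next
    case False
    then have "x \<le> v" using that by auto
    then have "\<theta> x \<le> - K" using uv assms(1) by (metis strict_mono_less_eq)
    then show ?thesis by auto
  qed
  then show "\<exists>K. \<forall>x. \<bar>x\<bar> \<ge> K \<longrightarrow> \<bar>q (\<theta> x)\<bar> > B" using K by blast
qed

text \<open>Between consecutive roots of the polynomials in \<open>F\<close> both specialisations of \<open>a\<close> are strictly
  monotone in the same direction, so it suffices to move their roots onto each other inside these
  cells.\<close>

lemma matches_insert:
  assumes fin: "finite F" and m: "matches F y z \<theta>" and der: "(d, derivc a) \<in> F"
    and lead: "a (Suc d) y \<noteq> 0" "a (Suc d) z \<noteq> 0"
    and det: "\<And>k b x. (k,b) \<in> F \<Longrightarrow> ev k b y x = 0 \<Longrightarrow> \<exists>x. ev k b y x \<noteq> 0 \<Longrightarrow>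
       sgn (ev (Suc d) a y x) = sgn (ev (Suc d) a z (\<theta> x))"
  shows "\<exists>\<theta>. matches (insert (Suc d, a) F) y z \<theta>"
proof -
  have \<theta>: "strict_mono \<theta>" "surj \<theta>" "\<And>k b x. (k,b) \<in> F \<Longrightarrow> sgn (ev k b y x) = sgn (ev k b z (\<theta> x))"
    using m by (auto simp: matches_def)
  \<comment> \<open>Members vanishing identically over \<open>y\<close> are left out to keep
    \<open>R\<close> finite; their sign is constant in any case.\<close>
  define R where "R = (\<Union>(k,b)\<in>{(k,b)\<in>F. \<exists>x. ev k b y x \<noteq> 0}. {x. ev k b y x = 0})"
  define p where "p = ev (Suc d) a y"
  define q where "q x = ev (Suc d) a z (\<theta> x)" for x
  have finR: "finite R"
    unfolding R_def
  proof (rule finite_UN_I)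
    show "finite {(k, b). (k, b) \<in> F \<and> (\<exists>x. ev k b y x \<noteq> 0)}" by (rule finite_subset[OF _ fin]) auto
  qed (use finite_roots_ev in \<open>auto split: prod.splits\<close>)
  have sg: "\<forall>x\<in>R. sgn (p x) = sgn (q x)"
    unfolding R_def p_def q_def using det by blast
  have cp: "continuous_on UNIV p" unfolding p_def by (rule continuous_ev)
  have cq: "continuous_on UNIV q" unfolding q_def
    by (rule continuous_on_compose2[OF continuous_ev[of UNIV] strict_mono_surj_continuous[OF \<theta>(1,2)]]) auto
  have up: "unbounded_fun p" unfolding p_def by (rule unbounded_ev[of a d y, OF lead(1)])
  have uq: "unbounded_fun q" unfolding q_def by (rule unbounded_fun_compose[OF \<theta>(1,2) unbounded_ev[of a d z, OF lead(2)]])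
  have large: "\<exists>x. \<bar>p x\<bar> > B" for B
    using up unfolding unbounded_fun_def by (meson abs_ge_self)
  obtain x where "\<bar>p x\<bar> > 0" using large by blast
  then have rp: "finite {x. p x = 0}" unfolding p_def by (intro finite_roots_ev) auto
  \<comment> \<open>Hence the roots of the derivative belong to \<open>R\<close>, and it has a
    constant sign on each interval that avoids \<open>R\<close>.\<close>
  have dne: "\<exists>x. ev d (derivc a) y x \<noteq> 0"
  proof (rule ccontr)
    assume "\<not> ?thesis"
    then have "(p has_real_derivative 0) (at x)" for x
      unfolding p_def using ev_derivative[of d a y x] by simp
    then have "p x = p 0" for x using DERIV_isconst_all by blast
    then show False using large[of "\<bar>p 0\<bar>"] by (metis less_irrefl)
  qed
  have co: "comonotone R p q"
    unfolding comonotone_def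
  proof (intro allI impI)
    fix s t :: real assume st: "s < t" "{s<..<t} \<inter> R = {}"
    let ?p' = "ev d (derivc a) y" and ?q' = "ev d (derivc a) z"
    have nz: "?p' x \<noteq> 0" if "x \<in> {s<..<t}" for x
      using st(2) that der dne unfolding R_def by blast
    define c where "c = (s + t) / 2"
    have c: "c \<in> {s<..<t}" using st by (auto simp: c_def)
    define \<sigma> where "\<sigma> = sgn (?p' c)"
    have sp: "sgn (?p' x) = \<sigma>" if "x \<in> {s<..<t}" for x
      unfolding \<sigma>_def using that c nz by (intro sgn_const_of_no_root[of "{s<..<t}"] continuous_ev) auto
    have s0: "\<sigma> \<noteq> 0" using nz[OF c] by (simp add: \<sigma>_def sgn_eq_0_iff)
    have pos: "\<sigma> * w > 0" if "sgn w = \<sigma>" for w :: real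
      using that s0 by (metis linorder_neqE_linordered_idom mult_pos_pos mult_neg_neg sgn_0_0 sgn_greater sgn_less)
    have "strict_mono_on {s..t} (\<lambda>x. \<sigma> * p x)"
      unfolding p_def using sp by (intro strict_mono_of_deriv[OF ev_derivative] pos) auto
    \<comment> \<open>Over \<open>z\<close> the derivative inherits its sign from the one over
      \<open>y\<close>, because \<open>\<theta>\<close> already matches it.\<close>
    moreover have "strict_mono_on {\<theta> s..\<theta> t} (\<lambda>x. \<sigma> * ev (Suc d) a z x)"
    proof (intro strict_mono_of_deriv[OF ev_derivative] pos)
      fix x assume x: "x \<in> {\<theta> s<..<\<theta> t}"
      obtain u where u: "x = \<theta> u" using \<theta>(2) by (metis surjD)
      with x have "u \<in> {s<..<t}" using strict_mono_less[OF \<theta>(1)] by auto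
      then show "sgn (?q' x) = \<sigma>" using sp \<theta>(3)[OF der, of u] u by simp
    qed
    then have "strict_mono_on {s..t} (\<lambda>x. \<sigma> * q x)"
      unfolding q_def strict_mono_on_def using strict_mono_less[OF \<theta>(1)] strict_mono_less_eq[OF \<theta>(1)] by auto
    ultimately show "\<exists>\<sigma>. \<sigma> \<noteq> 0 \<and> strict_mono_on {s..t} (\<lambda>x. \<sigma> * p x) \<and> strict_mono_on {s..t} (\<lambda>x. \<sigma> * q x)"
      using s0 by blast
  qed
  obtain \<psi> where \<psi>: "strict_mono \<psi>" "surj \<psi>" "\<And>x. same_cell R x (\<psi> x)" "\<And>x. sgn (p x) = sgn (q (\<psi> x))"
    using adjust_signs[OF finR cp cq up uq co sg rp] by blast
  \<comment> \<open>The correction \<open>\<psi>\<close> moves points only within cells, where the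
    old members have constant sign, so the old matching survives.\<close>
  have "sgn (ev k b y x) = sgn (ev k b z (\<theta> (\<psi> x)))" if kb: "(k,b) \<in> F" for k b x
  proof -
    have "sgn (ev k b y x) = sgn (ev k b y (\<psi> x))"
    proof (cases "x = \<psi> x \<or> (\<forall>x. ev k b y x = 0)")
      case False
      then have e: "{min x (\<psi> x)..max x (\<psi> x)} \<inter> R = {}" using \<psi>(3)[of x] by (simp add: same_cell_def)
      have "ev k b y u \<noteq> 0" if "u \<in> {min x (\<psi> x)..max x (\<psi> x)}" for u
        using e that kb False unfolding R_def by blast
      then show ?thesis
        by (intro sgn_const_of_no_root[of "{min x (\<psi> x)..max x (\<psi> x)}"] continuous_ev) auto
    qed auto
    then show ?thesis using \<theta>(3)[OF kb] by simp
  qed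
  moreover have "strict_mono (\<theta> \<circ> \<psi>)" using \<theta> \<psi> by (intro strict_mono_o)
  moreover have "surj (\<theta> \<circ> \<psi>)" using \<psi>(2) \<theta>(2) by (rule comp_surj)
  ultimately have "matches (insert (Suc d, a) F) y z (\<theta> \<circ> \<psi>)"
    using \<psi>(4) by (auto simp: matches_def p_def q_def)
  then show ?thesis by blast
qed

text \<open>Induction on the degree, inserting the polynomials of the new degree one by one. The
  sign of \<open>a\<close> at a root of \<open>b\<close> is read off from a pseudo-remainder of
  lower degree, which is already matched, and from the sign of the leading coefficient of
  \<open>b\<close>.\<close>

lemma matches_levels:
  assumes C: "closed_levels d C" and fin: "\<And>e. e \<le> d \<Longrightarrow> finite (C e)"
    and lead: "\<And>e a j. e \<le> d \<Longrightarrow> a \<in> C e \<Longrightarrow> j \<le> d \<Longrightarrow> sgn (a j y) = sgn (a j z)"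
    and "e \<le> d"
  shows "\<exists>\<theta>. matches (SIGMA m:{..e}. C m) y z \<theta>"
  using \<open>e \<le> d\<close>
proof (induction e)
  case 0
  have "matches (SIGMA m:{..0}. C m) y z id"
    unfolding matches_def using lead[of 0 _ 0] by (auto simp: strict_mono_def ev_def)
  then show ?case by blast
next
  case (Suc e)
  define L where "L = (SIGMA m:{..e}. C m)"
  have e: "e < d" using Suc by simp
  have finL: "finite L" unfolding L_def using fin e by (auto intro!: finite_SigmaI)
  have mono: "C j \<subseteq> C i" if "i \<le> j" "j \<le> d" for i j
    using that
  proof (induction j rule: dec_induct)
    case (step n)
    then have "C (Suc n) \<subseteq> C n" using C by (auto simp: closed_levels_def)
    then show ?case using step by auto
  qed simp
  have zero: "(\<forall>x. ev k b y x = 0) \<longleftrightarrow> (\<forall>j\<le>k. b j y = 0)" for k b y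
    unfolding ev_def by (rule polyfun_eq_0)
  have "\<exists>\<theta>. matches (L \<union> {Suc e} \<times> X) y z \<theta>" if "finite X" "X \<subseteq> C (Suc e)" for X
    using that
  proof (induction X rule: finite_induct)
    case empty
    then show ?case using Suc by (simp add: L_def)
  next
    case (insert a X)
    then obtain \<theta> where \<theta>: "matches (L \<union> {Suc e} \<times> X) y z \<theta>" by auto
    have \<theta>s: "sgn (ev k b y x) = sgn (ev k b z (\<theta> x))" if "(k,b) \<in> L \<union> {Suc e} \<times> X" for k b x
      using \<theta> that unfolding matches_def by blast
    have a: "a \<in> C (Suc e)" using insert by simp
    have aL: "(e, a) \<in> L" "(e, derivc a) \<in> L"
      using C a e by (auto simp: L_def closed_levels_def)
    have ins: "L \<union> {Suc e} \<times> insert a X = insert (Suc e, a) (L \<union> {Suc e} \<times> X)" by auto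
    have s: "sgn (a (Suc e) y) = sgn (a (Suc e) z)" using lead[of "Suc e" a "Suc e"] a e by auto
    show ?case
    proof (cases "a (Suc e) y = 0")
      case True
      then have "a (Suc e) z = 0" using s by (simp add: sgn_eq_0_iff)
      then have "ev (Suc e) a y x = ev e a y x" "ev (Suc e) a z x = ev e a z x" for x
        using True by (simp_all add: ev_Suc)
      \<comment> \<open>With its leading coefficient zero over both parameters, \<open>a\<close>
        coincides with its truncation, which is in \<open>L\<close>.\<close>
      then have "matches (insert (Suc e, a) (L \<union> {Suc e} \<times> X)) y z \<theta>"
        using \<theta> \<theta>s[of e a] aL by (simp add: matches_def)
      then show ?thesis unfolding ins by blast
    next
      case False
      show ?thesis unfolding ins
      proof (rule matches_insert[OF _ \<theta>])
        show "finite (L \<union> {Suc e} \<times> X)" using finL insert.hyps by auto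
        show "(e, derivc a) \<in> L \<union> {Suc e} \<times> X" using aL by auto
        show "a (Suc e) y \<noteq> 0" "a (Suc e) z \<noteq> 0" using False s by (auto simp: sgn_eq_0_iff)
        fix k b x
        assume kb: "(k, b) \<in> L \<union> {Suc e} \<times> X" and root: "ev k b y x = 0" and ne: "\<exists>x. ev k b y x \<noteq> 0"
        have k: "k \<le> Suc e" "b \<in> C k" using kb insert.prems by (auto simp: L_def)
        \<comment> \<open>The index \<open>n\<close> is the true degree of \<open>b\<close> over
          \<open>y\<close>, and by the equality of signs also over \<open>z\<close>. Division is by
          the truncation at \<open>n\<close>, whose leading coefficient does not vanish; the levels
          decrease in degree, so the truncation and \<open>a\<close> are available there. A root
          excludes \<open>n = 0\<close>.\<close>
        define J where "J = {j. j \<le> k \<and> b j y \<noteq> 0}"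
        define n where "n = Max J"
        have "finite J" "J \<noteq> {}" using ne zero[of k b y] by (auto simp: J_def)
        then have nJ: "n \<in> J" and nmax: "\<And>j. j \<in> J \<Longrightarrow> j \<le> n"
          unfolding n_def by auto
        have n: "n \<le> k" "b n y \<noteq> 0" using nJ by (auto simp: J_def)
        have hi: "b j y = 0" "b j z = 0" if "n < j" "j \<le> k" for j
        proof -
          show "b j y = 0" using nmax[of j] that by (auto simp: J_def)
          then show "b j z = 0" using lead[of k b j] k that e by (simp add: sgn_eq_0_iff)
        qed
        have evn: "ev k b y u = ev n b y u" "ev k b z u = ev n b z u" for u
          unfolding ev_def using n(1) hi linorder_not_le by (auto intro!: sum.mono_neutral_right) blast+
        have "n \<noteq> 0" using n(2) root evn(1)[of x] by (intro notI) (simp add: ev_def)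
        then obtain i where i: "n = Suc i" by (cases n) auto
        have ie: "i \<le> e" using i n k by simp
        have "b \<in> C (Suc i)" using mono[of "Suc i" k] k n i e by auto
        moreover have "a \<in> C (Suc i)" using mono[of "Suc i" "Suc e"] a ie e by auto
        ultimately obtain r where r: "r \<in> C i" "prem_of (Suc e) a i b r"
          using C ie e unfolding closed_levels_def by (meson Suc_leI le_less_trans)
        then obtain N where N: "\<And>y x. ev (Suc i) b y x = 0 \<Longrightarrow> ev i r y x = b (Suc i) y ^ N * ev (Suc e) a y x"
          unfolding prem_of_def by blast
        have rootz: "ev k b z (\<theta> x) = 0" using \<theta>s[OF kb, of x] root by (simp add: sgn_eq_0_iff)
        have "sgn (b (Suc i) y ^ N * ev (Suc e) a y x) = sgn (b (Suc i) z ^ N * ev (Suc e) a z (\<theta> x))"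
          using N[of y x] N[of z "\<theta> x"] root rootz evn i \<theta>s[of i r x] r(1) ie by (simp add: L_def)
        moreover have "sgn (b (Suc i) y) = sgn (b (Suc i) z)" using lead[of k b "Suc i"] k n i e by auto
        ultimately show "sgn (ev (Suc e) a y x) = sgn (ev (Suc e) a z (\<theta> x))"
          using n(2) i by (auto simp: sgn_mult power_sgn sgn_eq_0_iff)
      qed
    qed
  qed
  from this[of "C (Suc e)"] have "\<exists>\<theta>. matches (L \<union> {Suc e} \<times> C (Suc e)) y z \<theta>"
    using fin Suc.prems by auto
  moreover have "L \<union> {Suc e} \<times> C (Suc e) = (SIGMA m:{..Suc e}. C m)"
    by (auto simp: L_def le_Suc_eq)
  ultimately show ?case by simp
qed

text \<open>The set \<open>Q\<close> collects the coefficients, up to index \<open>d\<close>, of all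
  levels. Equal signs on \<open>Q\<close> make every case distinction and every pseudo-division come
  out alike over \<open>y\<close> and \<open>z\<close>; then \<open>x'\<close> is the image of
  \<open>x\<close> under the matching.\<close>

theorem sign_elimination:
  assumes A: "function_algebra A" and P: "finite P" "\<forall>a\<in>P. \<forall>j. a j \<in> A"
  shows "\<exists>Q. finite Q \<and> Q \<subseteq> A \<and> (\<forall>y z. (\<forall>u\<in>Q. sgn (u y) = sgn (u z)) \<longrightarrow>
     (\<forall>x. \<exists>x'. \<forall>a\<in>P. sgn (ev d a y x) = sgn (ev d a z x')))"
proof -
  obtain C where C: "closed_levels d C" "C d = P" "\<And>e. e \<le> d \<Longrightarrow> finite (C e)"
    "\<And>e a j. e \<le> d \<Longrightarrow> a \<in> C e \<Longrightarrow> a j \<in> A"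
    using exists_closed_levels[OF A P, of d] by (elim exE conjE) blast
  define Q where "Q = (\<Union>e\<in>{..d}. \<Union>a\<in>C e. a ` {..d})"
  have "finite Q" using C(3) by (simp add: Q_def)
  moreover have "Q \<subseteq> A" using C(4) unfolding Q_def by blast
  moreover have "\<exists>x'. \<forall>a\<in>P. sgn (ev d a y x) = sgn (ev d a z x')"
    if "\<forall>u\<in>Q. sgn (u y) = sgn (u z)" for y z x
  proof -
    have "sgn (a j y) = sgn (a j z)" if "e \<le> d" "a \<in> C e" "j \<le> d" for e a j
    proof -
      have "a j \<in> Q" unfolding Q_def using that by blast
      then show ?thesis using \<open>\<forall>u\<in>Q. _\<close> by blast
    qed
    then obtain \<theta> where "matches (SIGMA m:{..d}. C m) y z \<theta>"
      using matches_levels[of d C y z d] C(1,3) by blast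
    then show ?thesis using C(2) unfolding matches_def by (intro exI[of _ "\<theta> x"]) blast
  qed
  ultimately show ?thesis by (intro exI[of _ Q] conjI allI impI) simp_all
qed

subsection \<open>Elimination of variables\<close>

text \<open>The set of variables is a parameter rather than a type, so that variables can be
  adjoined and eliminated one at a time.\<close>

inductive_set polyfun :: "'i set \<Rightarrow> (('i \<Rightarrow> real) \<Rightarrow> real) set" for I where
  const: "(\<lambda>_. c) \<in> polyfun I"
| coord: "i \<in> I \<Longrightarrow> (\<lambda>v. v i) \<in> polyfun I"
| add: "u \<in> polyfun I \<Longrightarrow> w \<in> polyfun I \<Longrightarrow> (\<lambda>v. u v + w v) \<in> polyfun I"
| mult: "u \<in> polyfun I \<Longrightarrow> w \<in> polyfun I \<Longrightarrow> (\<lambda>v. u v * w v) \<in> polyfun I"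

lemma function_algebra_polyfun: "function_algebra (polyfun I)"
  by (simp add: function_algebra_def polyfun.intros)

lemma polyfun_diff: "u \<in> polyfun I \<Longrightarrow> w \<in> polyfun I \<Longrightarrow> (\<lambda>v. u v - w v) \<in> polyfun I"
  by (rule function_algebraD(4)[OF function_algebra_polyfun])

lemma function_algebra_sum:
  assumes "function_algebra A" "\<And>i. i \<in> S \<Longrightarrow> f i \<in> A"
  shows "(\<lambda>v. \<Sum>i\<in>S. f i v) \<in> A"
  using assms(2)
proof (induction S rule: infinite_finite_induct)
  case (insert i S)
  then show ?case using function_algebraD(2)[OF assms(1), of "f i" "\<lambda>v. \<Sum>i\<in>S. f i v"] by simp
qed (use function_algebraD(1)[OF assms(1)] in auto)

lemma polyfun_cong:
  assumes "u \<in> polyfun I" "\<And>i. i \<in> I \<Longrightarrow> v i = w i"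
  shows "u v = u w"
  using assms by induction auto

text \<open>The vanishing of the coefficients beyond \<open>d\<close> lets sums and products be read
  at the common degree \<open>d + e\<close> in the induction.\<close>

lemma polyfun_expand:
  assumes "u \<in> polyfun (insert k I)"
  shows "\<exists>a d. (\<forall>j. a j \<in> polyfun I) \<and> (\<forall>j>d. a j = (\<lambda>_. 0)) \<and> (\<forall>v. u v = ev d a v (v k))"
  using assms
proof induction
  case (const c)
  show ?case
    by (intro exI[of _ "\<lambda>j. if j = 0 then (\<lambda>_. c) else (\<lambda>_. 0)"] exI[of _ 0])
       (auto simp: ev_def intro: polyfun.const)
next
  case (coord i)
  show ?case
  proof (cases "i = k")
    case True
    show ?thesis
      by (intro exI[of _ "\<lambda>j. if j = 1 then (\<lambda>_. 1) else (\<lambda>_. 0)"] exI[of _ 1])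
         (auto simp: ev_def True intro: polyfun.const)
  next
    case False
    then have "i \<in> I" using coord by auto
    then show ?thesis
      by (intro exI[of _ "\<lambda>j. if j = 0 then (\<lambda>v. v i) else (\<lambda>_. 0)"] exI[of _ 0])
         (auto simp: ev_def intro: polyfun.intros)
  qed
next
  case (add u w)
  from add(3) obtain a d where
    "\<forall>j. a j \<in> polyfun I" "\<forall>j>d. a j = (\<lambda>_. 0)" "\<forall>v. u v = ev d a v (v k)"
    by (elim exE conjE) (rule that)
  note a = this[rule_format]
  from add(4) obtain b e where
    "\<forall>j. b j \<in> polyfun I" "\<forall>j>e. b j = (\<lambda>_. 0)" "\<forall>v. w v = ev e b v (v k)"
    by (elim exE conjE) (rule that)
  note b = this[rule_format]
  have "u v = (\<Sum>j\<le>d+e. a j v * v k ^ j)" "w v = (\<Sum>j\<le>d+e. b j v * v k ^ j)" for v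
    unfolding a(3) b(3) ev_def using a(2) b(2) by (auto intro!: sum.mono_neutral_left) (metis linorder_not_le)+
  then have "u v + w v = ev (d+e) (\<lambda>j v. a j v + b j v) v (v k)" for v
    by (simp add: ev_def sum.distrib algebra_simps)
  moreover have "(\<lambda>v. a j v + b j v) \<in> polyfun I" for j using a(1) b(1) by (rule polyfun.add)
  moreover have "(\<lambda>v. a j v + b j v) = (\<lambda>_. 0)" if "j > d + e" for j using a(2)[of j] b(2)[of j] that by simp
  ultimately show ?case by (intro exI[of _ "\<lambda>j v. a j v + b j v"] exI[of _ "d+e"]) simp
next
  case (mult u w)
  from mult(3) obtain a d where
    "\<forall>j. a j \<in> polyfun I" "\<forall>j>d. a j = (\<lambda>_. 0)" "\<forall>v. u v = ev d a v (v k)"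
    by (elim exE conjE) (rule that)
  note a = this[rule_format]
  from mult(4) obtain b e where
    "\<forall>j. b j \<in> polyfun I" "\<forall>j>e. b j = (\<lambda>_. 0)" "\<forall>v. w v = ev e b v (v k)"
    by (elim exE conjE) (rule that)
  note b = this[rule_format]
  define c where "c r v = (\<Sum>i\<le>r. a i v * b (r - i) v)" for r v
  have "u v * w v = ev (d+e) c v (v k)" for v
    unfolding a(3) b(3) ev_def c_def using a(2) b(2) by (intro polynomial_product) simp_all
  moreover have "c j \<in> polyfun I" for j
    unfolding c_def[abs_def] by (intro function_algebra_sum[OF function_algebra_polyfun] polyfun.mult a(1) b(1))
  moreover have "c j = (\<lambda>_. 0)" if "j > d + e" for j
  proof
    fix v
    have "a i v * b (j - i) v = 0" if "i \<le> j" for i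
      using a(2)[of i] b(2)[of "j - i"] \<open>j > d + e\<close> that by (cases "i > d") auto
    then show "c j v = 0" unfolding c_def by (intro sum.neutral) simp
  qed
  ultimately show ?case by (intro exI[of _ c] exI[of _ "d+e"]) simp
qed

lemma polyfun_expand_finite:
  assumes "finite P" "P \<subseteq> polyfun (insert k I)"
  shows "\<exists>d. \<forall>u\<in>P. \<exists>a. (\<forall>j. a j \<in> polyfun I) \<and> (\<forall>v. u v = ev d a v (v k))"
  using assms
proof (induction P rule: finite_induct)
  case (insert u P)
  then obtain d where d: "\<forall>u\<in>P. \<exists>a. (\<forall>j. a j \<in> polyfun I) \<and> (\<forall>v. u v = ev d a v (v k))" by auto
  obtain a e where a: "\<And>j. a j \<in> polyfun I" "\<And>j. j > e \<Longrightarrow> a j = (\<lambda>_. 0)" "\<And>v. u v = ev e a v (v k)"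
    using polyfun_expand[of u k I] insert.prems by auto
  have pad: "\<exists>b. (\<forall>j. b j \<in> polyfun I) \<and> (\<forall>v. w v = ev (d+e) b v (v k))"
    if "\<And>j. a j \<in> polyfun I" "\<And>v. w v = ev n a v (v k)" "n \<le> d + e" for w a n
  proof (intro exI conjI allI)
    show "(if j \<le> n then a j else (\<lambda>_. 0)) \<in> polyfun I" for j using that(1) polyfun.const by auto
    show "w v = ev (d+e) (\<lambda>j. if j \<le> n then a j else (\<lambda>_. 0)) v (v k)" for v
      unfolding that(2) ev_def using that(3) by (intro sum.mono_neutral_cong_left) auto
  qed
  have "\<exists>b. (\<forall>j. b j \<in> polyfun I) \<and> (\<forall>v. w v = ev (d+e) b v (v k))" if "w \<in> insert u P" for w
  proof (cases "w = u")
    case True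
    then show ?thesis using pad[of a u e] a by simp
  next
    case False
    then have "\<exists>a. (\<forall>j. a j \<in> polyfun I) \<and> (\<forall>v. w v = ev d a v (v k))" using d that by simp
    then obtain a where "\<forall>j. a j \<in> polyfun I" "\<forall>v. w v = ev d a v (v k)" by (elim exE conjE) (rule that)
    then show ?thesis using pad[of a w d] by simp
  qed
  then show ?case by (intro exI[of _ "d+e"] ballI) simp
qed simp

lemma project_one:
  assumes P: "finite P" "P \<subseteq> polyfun (insert k I)" and k: "k \<notin> I"
  shows "\<exists>Q. finite Q \<and> Q \<subseteq> polyfun I \<and> (\<forall>v w. (\<forall>u\<in>Q. sgn (u v) = sgn (u w)) \<longrightarrow>
     (\<exists>x. \<forall>u\<in>P. sgn (u v) = sgn (u (w(k := x)))))"
proof -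
  obtain d where "\<forall>u\<in>P. \<exists>a. (\<forall>j. a j \<in> polyfun I) \<and> (\<forall>v. u v = ev d a v (v k))"
    using polyfun_expand_finite[OF P] by blast
  then obtain c where c: "\<And>u j. u \<in> P \<Longrightarrow> c u j \<in> polyfun I" "\<And>u v. u \<in> P \<Longrightarrow> u v = ev d (c u) v (v k)"
    by (subst (asm) bchoice_iff) auto
  have "\<forall>a\<in>c ` P. \<forall>j. a j \<in> polyfun I" using c(1) by blast
  from sign_elimination[OF function_algebra_polyfun finite_imageI[OF P(1)] this, of d]
  obtain Q where Q: "finite Q" "Q \<subseteq> polyfun I"
    "\<forall>y z. (\<forall>u\<in>Q. sgn (u y) = sgn (u z)) \<longrightarrow>
       (\<forall>x. \<exists>x'. \<forall>a\<in>c ` P. sgn (ev d a y x) = sgn (ev d a z x'))"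
    by (elim exE conjE) (rule that)
  \<comment> \<open>The coefficients do not involve \<open>k\<close>, so updating \<open>w\<close>
    at \<open>k\<close> changes only the point of evaluation.\<close>
  have inv: "ev d (c u) (w(k := x)) = ev d (c u) w" if "u \<in> P" for u w x
  proof -
    have "c u j (w(k := x)) = c u j w" for j
      using k by (intro polyfun_cong[OF c(1)[OF that]]) auto
    then show ?thesis by (simp add: ev_def[abs_def])
  qed
  have "\<exists>x. \<forall>u\<in>P. sgn (u v) = sgn (u (w(k := x)))" if "\<forall>u\<in>Q. sgn (u v) = sgn (u w)" for v w
  proof -
    from Q(3)[rule_format, of v w "v k"] that
    obtain x where x: "\<forall>a\<in>c ` P. sgn (ev d a v (v k)) = sgn (ev d a w x)" by blast
    show ?thesis
    proof (intro exI[of _ x] ballI)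
      fix u assume u: "u \<in> P"
      have "sgn (ev d (c u) v (v k)) = sgn (ev d (c u) w x)" using x u by simp
      then show "sgn (u v) = sgn (u (w(k := x)))"
        using c(2)[OF u, of v] c(2)[OF u, of "w(k := x)"] inv[OF u, of w x] by simp
    qed
  qed
  with Q show ?thesis by (intro exI[of _ Q]) simp
qed

text \<open>A semantic form of the Tarski--Seidenberg theorem.\<close>

lemma project_many:
  assumes "finite K" "finite P" "P \<subseteq> polyfun (I \<union> K)" "I \<inter> K = {}"
  shows "\<exists>Q. finite Q \<and> Q \<subseteq> polyfun I \<and> (\<forall>v w. (\<forall>u\<in>Q. sgn (u v) = sgn (u w)) \<longrightarrow>
     (\<exists>w'. (\<forall>i. i \<notin> K \<longrightarrow> w' i = w i) \<and> (\<forall>u\<in>P. sgn (u v) = sgn (u w'))))"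
  using assms
proof (induction K arbitrary: I rule: finite_induct)
  case empty
  then show ?case by (intro exI[of _ P]) auto
next
  case (insert k K)
  have PI: "P \<subseteq> polyfun (insert k I \<union> K)" "insert k I \<inter> K = {}" and k: "k \<notin> I" using insert by auto
  then obtain Q where Q: "finite Q" "Q \<subseteq> polyfun (insert k I)"
    "\<forall>v w. (\<forall>u\<in>Q. sgn (u v) = sgn (u w)) \<longrightarrow>
       (\<exists>w'. (\<forall>i. i \<notin> K \<longrightarrow> w' i = w i) \<and> (\<forall>u\<in>P. sgn (u v) = sgn (u w')))"
    using insert.IH[OF insert.prems(1) PI] by (elim exE conjE) (rule that)
  obtain Q' where Q': "finite Q'" "Q' \<subseteq> polyfun I"
    "\<forall>v w. (\<forall>u\<in>Q'. sgn (u v) = sgn (u w)) \<longrightarrow> (\<exists>x. \<forall>u\<in>Q. sgn (u v) = sgn (u (w(k := x))))"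
    using project_one[OF Q(1,2) k] by (elim exE conjE) (rule that)
  have "\<exists>w'. (\<forall>i. i \<notin> insert k K \<longrightarrow> w' i = w i) \<and> (\<forall>u\<in>P. sgn (u v) = sgn (u w'))"
    if h: "\<forall>u\<in>Q'. sgn (u v) = sgn (u w)" for v w
  proof -
    obtain x where "\<forall>u\<in>Q. sgn (u v) = sgn (u (w(k := x)))" using Q'(3)[rule_format, of v w] h by blast
    then obtain w' where "\<forall>i. i \<notin> K \<longrightarrow> w' i = (w(k := x)) i" "\<forall>u\<in>P. sgn (u v) = sgn (u w')"
      using Q(3)[rule_format, of v "w(k := x)"] by blast
    then show ?thesis by (intro exI[of _ w']) auto
  qed
  with Q' show ?case by (intro exI[of _ Q']) simp
qed

subsection \<open>The Hilbert basis theorem\<close>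

definition fun_ideal :: "('y \<Rightarrow> real) set \<Rightarrow> ('y \<Rightarrow> real) set \<Rightarrow> bool" where
  "fun_ideal A J \<longleftrightarrow> J \<subseteq> A \<and> (\<lambda>_. 0) \<in> J \<and> (\<forall>u\<in>J. \<forall>w\<in>J. (\<lambda>y. u y + w y) \<in> J) \<and>
     (\<forall>u\<in>J. \<forall>c\<in>A. (\<lambda>y. c y * u y) \<in> J)"

lemma fun_idealD:
  assumes "fun_ideal A J"
  shows "J \<subseteq> A" "(\<lambda>_. 0) \<in> J" "u \<in> J \<Longrightarrow> w \<in> J \<Longrightarrow> (\<lambda>y. u y + w y) \<in> J"
    "u \<in> J \<Longrightarrow> c \<in> A \<Longrightarrow> (\<lambda>y. c y * u y) \<in> J"
  using assms by (simp_all add: fun_ideal_def)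

text \<open>Finite generation of \<open>J\<close>, phrased without linear combinations: every ideal containing the
  generators contains \<open>J\<close>.\<close>

definition noetherian :: "('y \<Rightarrow> real) set \<Rightarrow> bool" where
  "noetherian A \<longleftrightarrow> (\<forall>J. fun_ideal A J \<longrightarrow>
     (\<exists>F. finite F \<and> F \<subseteq> J \<and> (\<forall>I. fun_ideal A I \<longrightarrow> F \<subseteq> I \<longrightarrow> J \<subseteq> I)))"

lemma noetherian_polyfun_empty: "noetherian (polyfun {})"
  unfolding noetherian_def
proof (intro allI impI)
  fix J :: "(('a \<Rightarrow> real) \<Rightarrow> real) set" assume J: "fun_ideal (polyfun {}) J"
  have const: "\<exists>c. u = (\<lambda>_. c)" if "u \<in> polyfun {}" for u :: "('a \<Rightarrow> real) \<Rightarrow> real"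
    using polyfun_cong[OF that] by blast
  show "\<exists>F. finite F \<and> F \<subseteq> J \<and> (\<forall>I. fun_ideal (polyfun {}) I \<longrightarrow> F \<subseteq> I \<longrightarrow> J \<subseteq> I)"
  proof (cases "J \<subseteq> {\<lambda>_. 0}")
    case True
    then show ?thesis by (intro exI[of _ "{}"]) (auto simp: fun_ideal_def)
  next
    case False
    then obtain u where u: "u \<in> J" "u \<noteq> (\<lambda>_. 0)" by blast
    then obtain c where c: "u = (\<lambda>_. c)" using const J by (auto simp: fun_ideal_def)
    have "w \<in> I" if I: "fun_ideal (polyfun {}) I" "u \<in> I" and w: "w \<in> J" for I w
    proof -
      obtain e where e: "w = (\<lambda>_. e)" using const w J by (auto simp: fun_ideal_def)
      have "(\<lambda>y. (\<lambda>_. e / c) y * u y) \<in> I"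
        by (rule fun_idealD(4)[OF I polyfun.const])
      moreover have "c \<noteq> 0" using u(2) c by auto
      ultimately show ?thesis unfolding c e by simp
    qed
    with u(1) show ?thesis by (intro exI[of _ "{u}"]) auto
  qed
qed

text \<open>The coefficient at \<open>d\<close> counts as leading even when it is zero; this makes
  the set an ideal.\<close>

definition lead_coeffs :: "'i \<Rightarrow> 'i set \<Rightarrow> nat \<Rightarrow> (('i \<Rightarrow> real) \<Rightarrow> real) set \<Rightarrow> (('i \<Rightarrow> real) \<Rightarrow> real) set" where
  "lead_coeffs k I d J = {b. \<exists>a. (\<forall>j. a j \<in> polyfun I) \<and> (\<lambda>v. ev d a v (v k)) \<in> J \<and> b = a d}"

lemma polyfun_mono: "I \<subseteq> J \<Longrightarrow> polyfun I \<subseteq> polyfun J"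
proof
  fix u assume "I \<subseteq> J" "u \<in> polyfun I"
  from this(2,1) show "u \<in> polyfun J" by induction (auto intro: polyfun.intros)
qed

lemma polyfun_power: "u \<in> polyfun I \<Longrightarrow> (\<lambda>v. u v ^ n) \<in> polyfun I"
  by (induction n) (auto intro: polyfun.intros)

lemma lead_coeffs_ideal:
  assumes J: "fun_ideal (polyfun (insert k I)) J"
  shows "fun_ideal (polyfun I) (lead_coeffs k I d J)"
  unfolding fun_ideal_def
proof (intro conjI ballI)
  have J0: "(\<lambda>_. 0) \<in> J" and Ja: "\<And>u w. u \<in> J \<Longrightarrow> w \<in> J \<Longrightarrow> (\<lambda>y. u y + w y) \<in> J"
    and Jm: "\<And>u c. u \<in> J \<Longrightarrow> c \<in> polyfun (insert k I) \<Longrightarrow> (\<lambda>y. c y * u y) \<in> J"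
    using J by (simp_all add: fun_ideal_def)
  show "lead_coeffs k I d J \<subseteq> polyfun I" by (auto simp: lead_coeffs_def)
  show "(\<lambda>_. 0) \<in> lead_coeffs k I d J"
    unfolding lead_coeffs_def using J0 by (auto simp: ev_def intro!: exI[of _ "\<lambda>_ _. 0"] polyfun.const)
  fix u assume "u \<in> lead_coeffs k I d J"
  then obtain a where a: "\<forall>j. a j \<in> polyfun I" "(\<lambda>v. ev d a v (v k)) \<in> J" "u = a d"
    unfolding lead_coeffs_def by blast
  {
    fix w assume "w \<in> lead_coeffs k I d J"
    then obtain b where b: "\<forall>j. b j \<in> polyfun I" "(\<lambda>v. ev d b v (v k)) \<in> J" "w = b d"
      unfolding lead_coeffs_def by blast
    have "(\<lambda>v. ev d (\<lambda>j v. a j v + b j v) v (v k)) \<in> J"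
      using Ja[OF a(2) b(2)] by (simp add: ev_def sum.distrib distrib_right)
    moreover have "\<forall>j. (\<lambda>v. a j v + b j v) \<in> polyfun I" using a(1) b(1) polyfun.add by blast
    ultimately show "(\<lambda>y. u y + w y) \<in> lead_coeffs k I d J"
      unfolding lead_coeffs_def a(3) b(3) by (intro CollectI exI[of _ "\<lambda>j v. a j v + b j v"]) simp
  }
  fix c assume c: "c \<in> polyfun I"
  then have "c \<in> polyfun (insert k I)" using polyfun_mono by blast
  from Jm[OF a(2) this] have "(\<lambda>v. ev d (\<lambda>j v. c v * a j v) v (v k)) \<in> J"
    by (simp add: ev_def sum_distrib_left mult.assoc)
  moreover have "\<forall>j. (\<lambda>v. c v * a j v) \<in> polyfun I" using a(1) c polyfun.mult by blast
  ultimately show "(\<lambda>y. c y * u y) \<in> lead_coeffs k I d J"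
    unfolding lead_coeffs_def a(3) by (intro CollectI exI[of _ "\<lambda>j v. c v * a j v"]) simp
qed

text \<open>Multiplication by \<open>v k ^ (e - d)\<close> raises the degree and keeps the leading
  coefficient.\<close>

lemma lead_coeffs_mono:
  assumes J: "fun_ideal (polyfun (insert k I)) J" and "d \<le> e"
  shows "lead_coeffs k I d J \<subseteq> lead_coeffs k I e J"
proof
  fix u assume "u \<in> lead_coeffs k I d J"
  then obtain a where a: "\<forall>j. a j \<in> polyfun I" "(\<lambda>v. ev d a v (v k)) \<in> J" "u = a d"
    unfolding lead_coeffs_def by blast
  define b where "b j = (\<lambda>v. if e - d \<le> j then a (j - (e - d)) v else 0)" for j
  have "(\<lambda>v. v k ^ (e-d)) \<in> polyfun (insert k I)" by (intro polyfun_power polyfun.coord) simp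
  then have "(\<lambda>v. v k ^ (e-d) * ev d a v (v k)) \<in> J" by (intro fun_idealD(4)[OF J a(2)])
  moreover have "v k ^ (e-d) * ev d a v (v k) = ev e b v (v k)" for v
    using ev_shift[of "e-d" e a v "v k"] \<open>d \<le> e\<close> by (simp add: b_def ev_def)
  moreover have "b j \<in> polyfun I" for j
    using a(1) polyfun.const[of 0 I] by (cases "e - d \<le> j") (simp_all add: b_def)
  moreover have "u = b e" using \<open>d \<le> e\<close> by (simp add: b_def a(3))
  ultimately show "u \<in> lead_coeffs k I e J"
    unfolding lead_coeffs_def by (intro CollectI exI[of _ b]) simp
qed

text \<open>Hilbert's argument. The generators of the union of the increasing ideals
  \<open>L d\<close> lie in a single \<open>L D\<close>, so the chain stops there. Lifts of
  generators of \<open>L 0\<close>, ..., \<open>L D\<close> generate \<open>J\<close>: subtracting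
  an element with the same leading coefficient lowers the degree.\<close>

lemma noetherian_insert:
  assumes noeth: "noetherian (polyfun I)"
  shows "noetherian (polyfun (insert k I))"
  unfolding noetherian_def
proof (intro allI impI)
  fix J assume J: "fun_ideal (polyfun (insert k I)) J"
  define L where "L d = lead_coeffs k I d J" for d
  have L: "fun_ideal (polyfun I) (L d)" for d unfolding L_def by (rule lead_coeffs_ideal[OF J])
  have Lmono: "L d \<subseteq> L e" if "d \<le> e" for d e unfolding L_def by (rule lead_coeffs_mono[OF J that])
  have "fun_ideal (polyfun I) (\<Union>d. L d)"
    unfolding fun_ideal_def
  proof (intro conjI ballI)
    show "(\<Union>d. L d) \<subseteq> polyfun I" "(\<lambda>_. 0) \<in> (\<Union>d. L d)"
      using fun_idealD(1,2)[OF L] by blast+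
    fix u assume "u \<in> (\<Union>d. L d)"
    then obtain d where u: "u \<in> L d" by blast
    {
      fix w assume "w \<in> (\<Union>d. L d)"
      then obtain e where "w \<in> L e" by blast
      with u have "u \<in> L (max d e)" "w \<in> L (max d e)" using Lmono[of d "max d e"] Lmono[of e "max d e"] by auto
      then have "(\<lambda>y. u y + w y) \<in> L (max d e)" by (rule fun_idealD(3)[OF L])
      then show "(\<lambda>y. u y + w y) \<in> (\<Union>d. L d)" by blast
    }
    fix c assume "c \<in> polyfun I"
    then have "(\<lambda>y. c y * u y) \<in> L d" by (rule fun_idealD(4)[OF L u])
    then show "(\<lambda>y. c y * u y) \<in> (\<Union>d. L d)" by blast
  qed
  then obtain F where F: "finite F" "F \<subseteq> (\<Union>d. L d)" "\<forall>I'. fun_ideal (polyfun I) I' \<longrightarrow> F \<subseteq> I' \<longrightarrow> (\<Union>d. L d) \<subseteq> I'"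
    using noeth unfolding noetherian_def by meson
  have "\<exists>D. F \<subseteq> L D"
    using F(1,2)
  proof (induction F rule: finite_induct)
    case (insert u F)
    then obtain D e where "F \<subseteq> L D" "u \<in> L e" by auto
    then show ?case using Lmono[of D "max D e"] Lmono[of e "max D e"] by (intro exI[of _ "max D e"]) auto
  qed simp
  then obtain D where "F \<subseteq> L D" by blast
  then have LD: "L d \<subseteq> L D" for d using F(3) L by blast
  have "\<forall>d. \<exists>F. finite F \<and> F \<subseteq> L d \<and> (\<forall>I'. fun_ideal (polyfun I) I' \<longrightarrow> F \<subseteq> I' \<longrightarrow> L d \<subseteq> I')"
    using noeth L unfolding noetherian_def by blast
  then obtain E where E: "\<And>d. finite (E d)" "\<And>d. E d \<subseteq> L d"
    "\<And>d I'. fun_ideal (polyfun I) I' \<Longrightarrow> E d \<subseteq> I' \<Longrightarrow> L d \<subseteq> I'"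
    by metis
  define rep where "rep f d b \<longleftrightarrow> (\<exists>a. (\<forall>j. a j \<in> polyfun I) \<and> f = (\<lambda>v. ev d a v (v k)) \<and> b = a d)" for f d b
  have Lrep: "b \<in> lead_coeffs k I d K \<longleftrightarrow> (\<exists>f. f \<in> K \<and> rep f d b)" for b d K
    unfolding lead_coeffs_def rep_def by auto
  define g where "g d b = (SOME f. f \<in> J \<and> rep f d b)" for d b
  have g: "g d b \<in> J \<and> rep (g d b) d b" if "b \<in> E d" for d b
  proof -
    have "\<exists>f. f \<in> J \<and> rep f d b" using E(2)[of d] that Lrep unfolding L_def by blast
    then show ?thesis unfolding g_def by (rule someI_ex)
  qed
  define G where "G = (\<Union>d\<in>{..D}. g d ` E d)"
  have "finite G" "G \<subseteq> J" using E(1) g by (auto simp: G_def)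
  moreover have "J \<subseteq> I'" if I': "fun_ideal (polyfun (insert k I)) I'" "G \<subseteq> I'" for I'
  proof -
    have I'0: "(\<lambda>_. 0) \<in> I'" and I'a: "\<And>u w. u \<in> I' \<Longrightarrow> w \<in> I' \<Longrightarrow> (\<lambda>y. u y + w y) \<in> I'"
      and I'm: "\<And>u c. u \<in> I' \<Longrightarrow> c \<in> polyfun (insert k I) \<Longrightarrow> (\<lambda>y. c y * u y) \<in> I'"
      using I' by (simp_all add: fun_ideal_def)
    have Ja: "\<And>u w. u \<in> J \<Longrightarrow> w \<in> J \<Longrightarrow> (\<lambda>y. u y + w y) \<in> J"
      and Jm: "\<And>u c. u \<in> J \<Longrightarrow> c \<in> polyfun (insert k I) \<Longrightarrow> (\<lambda>y. c y * u y) \<in> J"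
      using J by (simp_all add: fun_ideal_def)
    \<comment> \<open>Taking leading coefficients of \<open>J \<inter> I'\<close> yields elements of
      both ideals with a prescribed leading coefficient, without writing linear combinations of the
      lifts.\<close>
    have JI: "fun_ideal (polyfun (insert k I)) (J \<inter> I')"
      using J I'(1) unfolding fun_ideal_def by blast
    have red: "\<exists>h. h \<in> J \<inter> I' \<and> rep h d c"
      if c: "c \<in> L d" for c d
    proof -
      \<comment> \<open>No leading coefficients are new above \<open>D\<close>, so a lift of degree
        at most \<open>D\<close> is taken and raised back to degree \<open>d\<close>.\<close>
      define e where "e = min d D"
      have "c \<in> L e" using c LD by (cases "d \<le> D") (auto simp: e_def)
      moreover have "E e \<subseteq> lead_coeffs k I e (J \<inter> I')"
      proof
        fix b assume b: "b \<in> E e"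
        then have "g e b \<in> G" unfolding G_def by (intro UN_I[of e]) (auto simp: e_def)
        then have "g e b \<in> J \<inter> I'" using g[OF b] I'(2) by blast
        then show "b \<in> lead_coeffs k I e (J \<inter> I')" using g[OF b] Lrep by blast
      qed
      ultimately have "c \<in> lead_coeffs k I e (J \<inter> I')" using E(3) lead_coeffs_ideal[OF JI] by blast
      then have "c \<in> lead_coeffs k I d (J \<inter> I')" using lead_coeffs_mono[OF JI, of e d] by (auto simp: e_def)
      then show ?thesis unfolding Lrep .
    qed
    have step: "f \<in> I'" if f: "f \<in> J" "h \<in> J" "h \<in> I'" and r: "(\<lambda>v. f v - h v) \<in> J \<Longrightarrow> (\<lambda>v. f v - h v) \<in> I'" for f h
    proof -
      have "(\<lambda>v. (-1) * h v) \<in> J" using Jm[OF f(2), of "\<lambda>_. -1"] by (simp add: polyfun.const)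
      from Ja[OF f(1) this] have "(\<lambda>v. f v - h v) \<in> J" by simp
      from I'a[OF r[OF this] f(3)] show ?thesis by simp
    qed
    have "(\<lambda>v. ev d a v (v k)) \<in> I'" if "\<forall>j. a j \<in> polyfun I" "(\<lambda>v. ev d a v (v k)) \<in> J" for d a
      using that
    proof (induction d arbitrary: a)
      case 0
      then have "a 0 \<in> L 0" unfolding L_def Lrep rep_def by blast
      from red[OF this] obtain h b where h: "h \<in> J" "h \<in> I'" "h = (\<lambda>v. ev 0 b v (v k))" "a 0 = b 0"
        unfolding rep_def by blast
      show ?case using I'0 h by (intro step[OF 0(2) h(1,2)]) (simp add: ev_def)
    next
      case (Suc d)
      then have "a (Suc d) \<in> L (Suc d)" unfolding L_def Lrep rep_def by blast
      from red[OF this] obtain h b where h: "h \<in> J" "h \<in> I'" "\<forall>j. b j \<in> polyfun I"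
        "h = (\<lambda>v. ev (Suc d) b v (v k))" "a (Suc d) = b (Suc d)" unfolding rep_def by blast
      have *: "(\<lambda>v. ev (Suc d) a v (v k) - h v) = (\<lambda>v. ev d (\<lambda>j v. a j v - b j v) v (v k))"
        unfolding h(4) ev_Suc h(5) by (simp add: ev_def sum_subtractf left_diff_distrib)
      have "\<forall>j. (\<lambda>v. a j v - b j v) \<in> polyfun I" using Suc.prems(1) h(3) polyfun_diff by blast
      from Suc.IH[OF this] show ?case
        unfolding *[symmetric] by (intro step[OF Suc.prems(2) h(1,2)])
    qed
    moreover have "\<exists>d a. (\<forall>j. a j \<in> polyfun I) \<and> f = (\<lambda>v. ev d a v (v k))" if "f \<in> J" for f
    proof -
      have "f \<in> polyfun (insert k I)" using that J by (auto simp: fun_ideal_def)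
      from polyfun_expand[OF this] obtain a d where "\<forall>j. a j \<in> polyfun I" "\<forall>v. f v = ev d a v (v k)"
        by (elim exE conjE) (rule that)
      then show ?thesis by (intro exI[of _ d] exI[of _ a]) auto
    qed
    ultimately show ?thesis by fastforce
  qed
  ultimately show "\<exists>F. finite F \<and> F \<subseteq> J \<and> (\<forall>I'. fun_ideal (polyfun (insert k I)) I' \<longrightarrow> F \<subseteq> I' \<longrightarrow> J \<subseteq> I')"
    by (intro exI[of _ G]) simp
qed

lemma noetherian_polyfun: "finite I \<Longrightarrow> noetherian (polyfun I)"
  by (induction I rule: finite_induct) (simp_all add: noetherian_polyfun_empty noetherian_insert)

subsection \<open>Sign of polynomials on thin regions\<close>

lemma ev_in_polyfun:
  assumes "\<And>j. a j \<in> polyfun I" "k \<in> I"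
  shows "(\<lambda>v. ev d a v (v k)) \<in> polyfun I"
  unfolding ev_def
  by (intro function_algebra_sum[OF function_algebra_polyfun] polyfun.mult polyfun_power polyfun.coord assms)

text \<open>The coordinates \<open>T\<close> and \<open>S\<close> play the roles of a large number and of a number that is small compared
  with its negative powers.\<close>

definition thin_region :: "'i \<Rightarrow> 'i \<Rightarrow> nat \<Rightarrow> ('i \<Rightarrow> real) set" where
  "thin_region T S N = {v. v T \<ge> real N + 1 \<and> 0 < v S \<and> v S * v T ^ N < 1}"

text \<open>One number serves both as a lower bound for \<open>T\<close> and as an exponent, so
  finitely many requirements are met together by enlarging it.\<close>

lemma thin_region_mono:
  assumes "M \<le> N"
  shows "thin_region T S N \<subseteq> thin_region T S M"
proof
  fix v assume v: "v \<in> thin_region T S N"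
  then have t: "v T \<ge> 1" and s: "0 < v S" by (auto simp: thin_region_def)
  have "v S * v T ^ M \<le> v S * v T ^ N"
    using power_increasing[OF assms t] s by simp
  also have "\<dots> < 1" using v by (simp add: thin_region_def)
  finally show "v \<in> thin_region T S M" using v assms by (simp add: thin_region_def)
qed

lemma polyfun_upper_bound:
  assumes "u \<in> polyfun {T, S}"
  shows "\<exists>N K. \<forall>v\<in>thin_region T S N. \<bar>u v\<bar> \<le> v T ^ K"
  using assms
proof induction
  case (const c)
  obtain n :: nat where "\<bar>c\<bar> \<le> real n" using real_arch_simple by blast
  then have "\<bar>c\<bar> \<le> v T ^ 1" if "v \<in> thin_region T S n" for v
    using that by (simp add: thin_region_def)
  then show ?case by blast
next
  case (coord i)
  have "\<bar>v i\<bar> \<le> v T ^ 1" if "v \<in> thin_region T S 0" for v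
    using that coord by (auto simp: thin_region_def)
  then show ?case by blast
next
  case (add u w)
  then obtain N K M L where
    *: "\<forall>v\<in>thin_region T S N. \<bar>u v\<bar> \<le> v T ^ K" "\<forall>v\<in>thin_region T S M. \<bar>w v\<bar> \<le> v T ^ L"
    by blast
  \<comment> \<open>The summand 1 forces \<open>v T >= 2\<close>, so one more power of
    \<open>v T\<close> absorbs the factor 2.\<close>
  have "\<bar>u v + w v\<bar> \<le> v T ^ (K + L + 1)" if "v \<in> thin_region T S (N + M + 1)" for v
  proof -
    have t: "v T \<ge> 2" using that by (auto simp: thin_region_def)
    have "\<bar>u v\<bar> \<le> v T ^ K" "\<bar>w v\<bar> \<le> v T ^ L"
      using that * thin_region_mono[of N "N+M+1" T S] thin_region_mono[of M "N+M+1" T S] by auto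
    moreover have "v T ^ K \<le> v T ^ (K + L)" "v T ^ L \<le> v T ^ (K + L)"
      using t by (auto intro!: power_increasing)
    ultimately have "\<bar>u v + w v\<bar> \<le> 2 * v T ^ (K+L)" by linarith
    also have "\<dots> \<le> v T * v T ^ (K+L)" using t by (intro mult_right_mono) auto
    finally show ?thesis by simp
  qed
  then show ?case by blast
next
  case (mult u w)
  then obtain N K M L where
    *: "\<forall>v\<in>thin_region T S N. \<bar>u v\<bar> \<le> v T ^ K" "\<forall>v\<in>thin_region T S M. \<bar>w v\<bar> \<le> v T ^ L"
    by blast
  have "\<bar>u v * w v\<bar> \<le> v T ^ (K + L)" if "v \<in> thin_region T S (N + M)" for v
  proof -
    have "\<bar>u v\<bar> \<le> v T ^ K" "\<bar>w v\<bar> \<le> v T ^ L"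
      using that * thin_region_mono[of N "N+M" T S] thin_region_mono[of M "N+M" T S] by auto
    then show ?thesis unfolding abs_mult power_add by (intro mult_mono) auto
  qed
  then show ?case by blast
qed

text \<open>The lower bound \<open>\<delta>\<close> is what lets the sign survive a small
  perturbation later.\<close>

lemma polynomial_eventual_sign:
  fixes c :: "nat \<Rightarrow> real"
  shows "(\<forall>t. (\<Sum>j\<le>e. c j * t ^ j) = 0) \<or>
    (\<exists>N \<delta> \<sigma>. \<delta> > 0 \<and> (\<forall>t\<ge>N. \<bar>\<Sum>j\<le>e. c j * t ^ j\<bar> \<ge> \<delta> \<and> sgn (\<Sum>j\<le>e. c j * t ^ j) = \<sigma>))"
proof (induction e arbitrary: c)
  case 0
  show ?case
  proof (cases "c 0 = 0")
    case False
    then show ?thesis by (intro disjI2 exI[of _ 0] exI[of _ "\<bar>c 0\<bar>"] exI[of _ "sgn (c 0)"]) auto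
  qed simp
next
  case (Suc e)
  define q where "q t = (\<Sum>j\<le>e. c (Suc j) * t ^ j)" for t
  have s: "(\<Sum>j\<le>Suc e. c j * t ^ j) = c 0 + t * q t" for t
    unfolding q_def by (subst sum.atMost_Suc_shift) (simp add: sum_distrib_left mult_ac)
  from Suc.IH[of "\<lambda>j. c (Suc j)"]
  consider "\<forall>t. q t = 0" | N \<delta> \<sigma> where "\<delta> > 0" "\<forall>t\<ge>N. \<bar>q t\<bar> \<ge> \<delta> \<and> sgn (q t) = \<sigma>"
    unfolding q_def by blast
  then show ?case
  proof cases
    case 1
    show ?thesis unfolding s 1[rule_format]
      by (cases "c 0 = 0") (auto intro!: exI[of _ "\<bar>c 0\<bar>"])
  next
    case 2
    \<comment> \<open>Beyond this bound \<open>t * q t\<close> exceeds the constant term by at least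
      1 in absolute value and therefore decides the sign.\<close>
    define M where "M = max (max N 1) ((\<bar>c 0\<bar> + 1) / \<delta>)"
    have "\<bar>c 0 + t * q t\<bar> \<ge> 1 \<and> sgn (c 0 + t * q t) = \<sigma>" if "t \<ge> M" for t
    proof -
      have t: "t \<ge> N" "t \<ge> 1" "t \<ge> (\<bar>c 0\<bar> + 1) / \<delta>" using that by (auto simp: M_def)
      have q: "\<bar>q t\<bar> \<ge> \<delta>" "sgn (q t) = \<sigma>" using 2(2) t(1) by auto
      have "\<bar>c 0\<bar> + 1 \<le> t * \<delta>" using t(3) 2(1) by (simp add: divide_le_eq)
      also have "\<dots> \<le> t * \<bar>q t\<bar>" using q t by (intro mult_left_mono) auto
      also have "\<dots> = \<bar>t * q t\<bar>" using t by (simp add: abs_mult)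
      finally have b: "\<bar>c 0\<bar> + 1 \<le> \<bar>t * q t\<bar>" .
      have sg: "sgn (t * q t) = \<sigma>" using t q by (simp add: sgn_mult)
      have "sgn (c 0 + t * q t) = sgn (t * q t)" using b by (auto simp: sgn_real_def abs_real_def split: if_splits)
      then show ?thesis using b sg by linarith
    qed
    then show ?thesis unfolding s by (intro disjI2 exI[of _ M] exI[of _ 1] exI[of _ \<sigma>]) auto
  qed
qed

lemma polyfun_single_sign:
  assumes "a \<in> polyfun {T}"
  shows "(\<forall>v. a v = 0) \<or> (\<exists>N \<delta> \<sigma>. \<delta> > 0 \<and> (\<forall>v. v T \<ge> N \<longrightarrow> \<bar>a v\<bar> \<ge> \<delta> \<and> sgn (a v) = \<sigma>))"
proof -
  from polyfun_expand[OF assms] obtain b e where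
    b: "\<forall>j. b j \<in> polyfun {}" "\<forall>v. a v = ev e b v (v T)" by blast
  have "b j v = b j w" for j v w using polyfun_cong[of "b j" "{}" v w] b(1) by blast
  then have "ev e b v t = (\<Sum>j\<le>e. b j (\<lambda>_. 0) * t ^ j)" for v t
    unfolding ev_def by (intro sum.cong refl arg_cong2[of _ _ _ _ "(*)"])
  then have a: "a v = (\<Sum>j\<le>e. b j (\<lambda>_. 0) * v T ^ j)" for v using b(2) by simp
  show ?thesis unfolding a using polynomial_eventual_sign[of "\<lambda>j. b j (\<lambda>_. 0)" e] by blast
qed

text \<open>Write the polynomial as \<open>a 0 + S * q\<close> with \<open>a 0\<close> depending on
  \<open>T\<close> only. If \<open>a 0\<close> is identically zero, the sign is that of
  \<open>q\<close>, as \<open>S > 0\<close>. Otherwise \<open>a 0\<close> stays away from zero for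
  large \<open>T\<close>, and \<open>S * q\<close> is too small to matter, since \<open>q\<close> is
  bounded by a power of \<open>T\<close>.\<close>

lemma thin_region_sign:
  assumes "u \<in> polyfun {T, S}"
  shows "\<exists>N \<sigma>. \<forall>v\<in>thin_region T S N. sgn (u v) = \<sigma>"
proof -
  have "\<exists>N \<sigma>. \<forall>v\<in>thin_region T S N. sgn (ev d a v (v S)) = \<sigma>" if "\<forall>j. a j \<in> polyfun {T}" for d a
    using that
  proof (induction d arbitrary: a)
    case 0
    then have "a 0 \<in> polyfun {T}" by simp
    from polyfun_single_sign[OF this] show ?case
    proof
      assume "\<exists>N \<delta> \<sigma>. \<delta> > 0 \<and> (\<forall>v. v T \<ge> N \<longrightarrow> \<bar>a 0 v\<bar> \<ge> \<delta> \<and> sgn (a 0 v) = \<sigma>)"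
      then obtain N \<sigma> where N: "\<And>v. v T \<ge> N \<Longrightarrow> sgn (a 0 v) = \<sigma>" by blast
      obtain n :: nat where "N \<le> real n" using real_arch_simple by blast
      then have "\<forall>v\<in>thin_region T S n. sgn (ev 0 a v (v S)) = \<sigma>"
        using N by (auto simp: thin_region_def ev_def)
      then show ?thesis by blast
    qed (auto simp: ev_def)
  next
    case (Suc d)
    define q where "q v = ev d (\<lambda>j. a (Suc j)) v (v S)" for v
    have s: "ev (Suc d) a v (v S) = a 0 v + v S * q v" for v by (simp add: ev_split q_def)
    have "\<forall>j. a (Suc j) \<in> polyfun {T}" using Suc.prems by blast
    from Suc.IH[OF this] obtain N1 \<sigma>1 where 1: "\<forall>v\<in>thin_region T S N1. sgn (q v) = \<sigma>1"
      unfolding q_def by blast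
    have "q \<in> polyfun {T, S}"
      unfolding q_def[abs_def] using Suc.prems polyfun_mono[of "{T}" "{T,S}"]
      by (intro ev_in_polyfun) auto
    from polyfun_upper_bound[OF this] obtain N2 K where 2: "\<forall>v\<in>thin_region T S N2. \<bar>q v\<bar> \<le> v T ^ K" by blast
    have "a 0 \<in> polyfun {T}" using Suc.prems by blast
    from polyfun_single_sign[OF this] show ?case
    proof
      assume "\<forall>v. a 0 v = 0"
      then have "\<forall>v\<in>thin_region T S N1. sgn (ev (Suc d) a v (v S)) = \<sigma>1"
        using 1 unfolding s by (simp add: sgn_mult thin_region_def)
      then show ?thesis by blast
    next
      assume "\<exists>N \<delta> \<sigma>. \<delta> > 0 \<and> (\<forall>v. v T \<ge> N \<longrightarrow> \<bar>a 0 v\<bar> \<ge> \<delta> \<and> sgn (a 0 v) = \<sigma>)"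
      then obtain N3 \<delta> \<sigma> where 3: "\<delta> > 0" "\<And>v. v T \<ge> N3 \<Longrightarrow> \<bar>a 0 v\<bar> \<ge> \<delta> \<and> sgn (a 0 v) = \<sigma>" by blast
      obtain n3 n4 :: nat where n34: "N3 \<le> real n3" "1/\<delta> \<le> real n4" using real_arch_simple by metis
      \<comment> \<open>The exponent \<open>Suc K\<close> makes \<open>S * q\<close> smaller than
        \<open>1 / T\<close>; \<open>n3\<close> and \<open>n4\<close> ensure that \<open>T\<close>
        reaches \<open>N3\<close> and \<open>1 / \<delta>\<close>.\<close>
      define N where "N = N2 + Suc K + n3 + n4"
      have "sgn (a 0 v + v S * q v) = \<sigma>" if v: "v \<in> thin_region T S N" for v
      proof -
        have t: "v T \<ge> 1" "v T \<ge> N3" "v T \<ge> 1/\<delta>" and sp: "v S > 0" "v S * v T ^ N < 1"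
        proof -
          have "real N \<ge> real n3" "real N \<ge> real n4" by (simp_all add: N_def)
          moreover have "v T \<ge> real N + 1" using v by (simp add: thin_region_def)
          ultimately show "v T \<ge> 1" "v T \<ge> N3" "v T \<ge> 1/\<delta>" using n34 by linarith+
          show "v S > 0" "v S * v T ^ N < 1" using v by (simp_all add: thin_region_def)
        qed
        have "v \<in> thin_region T S N2" using v thin_region_mono[of N2 N T S] by (auto simp: N_def)
        then have "\<bar>q v\<bar> \<le> v T ^ K" using 2 by blast
        then have "\<bar>v S * q v\<bar> * v T \<le> v S * v T ^ K * v T"
          using sp t by (simp add: abs_mult)
        also have "\<dots> = v S * v T ^ Suc K" by simp
        also have "\<dots> \<le> v S * v T ^ N" using sp t by (intro mult_left_mono power_increasing) (auto simp: N_def)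
        finally have "\<bar>v S * q v\<bar> * v T < 1" using sp by simp
        then have "\<bar>v S * q v\<bar> < 1 / v T" using t by (simp add: less_divide_eq)
        also have "\<dots> \<le> \<delta>" using t 3(1) by (simp add: divide_le_eq mult.commute)
        finally have "\<bar>v S * q v\<bar> < \<bar>a 0 v\<bar>" using 3(2)[of v, OF t(2)] by linarith
        then have "sgn (a 0 v + v S * q v) = sgn (a 0 v)"
          by (auto simp: sgn_real_def abs_real_def split: if_splits)
        then show ?thesis using 3(2)[of v, OF t(2)] by simp
      qed
      then show ?thesis unfolding s by blast
    qed
  qed
  moreover have "u \<in> polyfun (insert S {T})" using assms by (simp add: insert_commute)
  from polyfun_expand[OF this] obtain a d where "\<forall>j. a j \<in> polyfun {T}" "\<forall>v. u v = ev d a v (v S)" by blast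
  ultimately show ?thesis by simp
qed

lemma thin_region_signs:
  assumes "finite Q" "Q \<subseteq> polyfun {T, S}"
  shows "\<exists>N. \<forall>v\<in>thin_region T S N. \<forall>w\<in>thin_region T S N. \<forall>u\<in>Q. sgn (u v) = sgn (u w)"
  using assms
proof (induction Q rule: finite_induct)
  case (insert u Q)
  then obtain N where N: "\<forall>v\<in>thin_region T S N. \<forall>w\<in>thin_region T S N. \<forall>u\<in>Q. sgn (u v) = sgn (u w)" by auto
  obtain M \<sigma> where M: "\<forall>v\<in>thin_region T S M. sgn (u v) = \<sigma>" using thin_region_sign[of u T S] insert.prems by auto
  have "thin_region T S (N + M) \<subseteq> thin_region T S N" "thin_region T S (N + M) \<subseteq> thin_region T S M"
    by (auto intro!: thin_region_mono)
  then show ?case using N M by (intro exI[of _ "N+M"]) (simp add: subset_iff)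
qed simp

subsection \<open>The Lojasiewicz inequality\<close>

text \<open>The map \<open>h\<close> names the coordinates, so that the space can be embedded among
  further variables.\<close>

lemma real_polynomial_polyfun:
  fixes p :: "real^'n \<Rightarrow> real"
  assumes "real_polynomial_function p"
  shows "(\<lambda>v. p (\<chi> i. v (h i))) \<in> polyfun (range h)"
  using assms
proof induction
  case (linear f)
  have fx: "f x = (\<Sum>i\<in>UNIV. f (axis i 1) * x $ i)" for x
  proof -
    have "f x = f (\<Sum>i\<in>UNIV. x $ i *\<^sub>R axis i 1)"
      using basis_expansion[of x] by (simp add: scalar_mult_eq_scaleR)
    also have "\<dots> = (\<Sum>i\<in>UNIV. f (axis i 1) * x $ i)"
      using linear by (simp add: linear_sum linear_cmul bounded_linear.linear mult.commute)
    finally show ?thesis .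
  qed
  have "f (\<chi> i. v (h i)) = (\<Sum>i\<in>UNIV. f (axis i 1) * v (h i))" for v
    using fx[of "\<chi> i. v (h i)"] by simp
  then have "(\<lambda>v. f (\<chi> i. v (h i))) = (\<lambda>v. \<Sum>i\<in>UNIV. f (axis i 1) * v (h i))" by (rule ext)
  also have "\<dots> \<in> polyfun (range h)"
    by (intro function_algebra_sum[OF function_algebra_polyfun] polyfun.intros) auto
  finally show ?case .
qed (auto intro: polyfun.intros)

text \<open>Elimination speaks of sign vectors only; this is the form of semialgebraicity that it
  can use.\<close>

lemma semialgebraic_sign_determined:
  fixes S :: "(real^'n) set"
  assumes "semialgebraic S"
  shows "\<exists>P. finite P \<and> (\<forall>p\<in>P. real_polynomial_function p) \<and>
    (\<forall>x y. (\<forall>p\<in>P. sgn (p x) = sgn (p y)) \<longrightarrow> (x \<in> S \<longleftrightarrow> y \<in> S))"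
  using assms
proof induction
  case (pos p)
  have "(x \<in> {x. 0 < p x}) = (y \<in> {x. 0 < p x})" if "sgn (p x) = sgn (p y)" for x y
    using that by (metis mem_Collect_eq sgn_greater)
  then have "\<forall>x y. (\<forall>p\<in>{p}. sgn (p x) = sgn (p y)) \<longrightarrow> (x \<in> {x. 0 < p x} \<longleftrightarrow> y \<in> {x. 0 < p x})"
    by blast
  moreover have "\<forall>p\<in>{p}. real_polynomial_function p" using pos by blast
  ultimately show ?case by (intro exI[of _ "{p}"] conjI) (rule finite.intros | assumption)+
next
  case (compl S)
  from compl(2) obtain P where "finite P" "\<forall>p\<in>P. real_polynomial_function p"
    "\<forall>x y. (\<forall>p\<in>P. sgn (p x) = sgn (p y)) \<longrightarrow> (x \<in> S \<longleftrightarrow> y \<in> S)"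
    by (elim exE conjE) (rule that)
  then show ?case by (intro exI[of _ P] conjI) blast+
next
  case (inter S T)
  then obtain P Q where "finite P" "\<forall>p\<in>P. real_polynomial_function p"
    "\<forall>x y. (\<forall>p\<in>P. sgn (p x) = sgn (p y)) \<longrightarrow> (x \<in> S \<longleftrightarrow> y \<in> S)" "finite Q" "\<forall>p\<in>Q. real_polynomial_function p"
    "\<forall>x y. (\<forall>p\<in>Q. sgn (p x) = sgn (p y)) \<longrightarrow> (x \<in> T \<longleftrightarrow> y \<in> T)"
    by (elim exE conjE) (rule that)
  then show ?case by (intro exI[of _ "P \<union> Q"] conjI) (blast | simp)+
next
  case (union S T)
  then obtain P Q where "finite P" "\<forall>p\<in>P. real_polynomial_function p"
    "\<forall>x y. (\<forall>p\<in>P. sgn (p x) = sgn (p y)) \<longrightarrow> (x \<in> S \<longleftrightarrow> y \<in> S)" "finite Q" "\<forall>p\<in>Q. real_polynomial_function p"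
    "\<forall>x y. (\<forall>p\<in>Q. sgn (p x) = sgn (p y)) \<longrightarrow> (x \<in> T \<longleftrightarrow> y \<in> T)"
    by (elim exE conjE) (rule that)
  then show ?case by (intro exI[of _ "P \<union> Q"] conjI) (blast | simp)+
qed

lemma real_polynomial_component: "real_polynomial_function (\<lambda>x::real^'n. x $ i)"
  by (intro real_polynomial_function.intros(1) bounded_linear_vec_nth)

lemma continuous_on_real_polynomial:
  "real_polynomial_function p \<Longrightarrow> continuous_on S p"
  using continuous_real_polymonial_function continuous_at_imp_continuous_on by blast

text \<open>By elimination, whether the fibre of points with \<open>F x = s\<close> and the bounds given by \<open>t\<close> is empty
  does not depend on \<open>(t, s)\<close> in a thin region. Were it nonempty, \<open>F\<close> would take arbitrarily small values
  on a compact set on which it is positive.\<close>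

lemma Lojasiewicz_fibres:
  fixes S :: "(real^'n) set"
  assumes S: "semialgebraic S" and F: "real_polynomial_function F" and g: "real_polynomial_function g"
    and nonneg: "\<And>x. F x \<ge> 0" and zero: "\<And>x. x \<in> closure S \<Longrightarrow> F x = 0 \<Longrightarrow> g x = 0"
  shows "\<exists>N. \<forall>x\<in>S. \<forall>t. real N + 1 \<le> t \<longrightarrow> (\<Sum>i\<in>UNIV. (x $ i)^2) \<le> t \<longrightarrow> 1 \<le> t * (g x)^2 \<longrightarrow> 1 \<le> F x * t ^ N"
proof -
  define T :: "'n + bool" where "T = Inr False"
  define Y :: "'n + bool" where "Y = Inr True"
  define h where "h v = (\<chi> i. v (Inl i))" for v :: "'n + bool \<Rightarrow> real"
  obtain P where P: "finite P" "\<forall>p\<in>P. real_polynomial_function p"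
    "\<forall>x y. (\<forall>p\<in>P. sgn (p x) = sgn (p y)) \<longrightarrow> (x \<in> S \<longleftrightarrow> y \<in> S)"
    using semialgebraic_sign_determined[OF S] by (elim exE conjE) (rule that)
  define q1 where "q1 v = v T * (g (h v))^2 - 1" for v
  define q2 where "q2 v = v T - (\<Sum>i\<in>UNIV. (h v $ i)^2)" for v
  define q3 where "q3 v = F (h v) - v Y" for v
  define P' where "P' = (\<lambda>p v. p (h v)) ` P \<union> {q1, q2, q3}"
  define E where "E v \<longleftrightarrow> h v \<in> S \<and> q1 v \<ge> 0 \<and> q2 v \<ge> 0 \<and> q3 v = 0" for v
  have TY: "range Inr = {T, Y}" by (auto simp: T_def Y_def UNIV_bool)
  have univ: "{T, Y} \<union> range Inl = UNIV"
    unfolding TY[symmetric] by (auto simp: image_iff) (metis sum.exhaust)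
  have poly: "(\<lambda>v. p (h v)) \<in> polyfun UNIV" if "real_polynomial_function p" for p
    using real_polynomial_polyfun[OF that, of Inl] polyfun_mono[of "range Inl" UNIV]
    by (auto simp: h_def[abs_def])
  have "(\<lambda>v. (g (h v))^2) \<in> polyfun UNIV" by (intro poly real_polynomial_function_power g)
  then have "q1 \<in> polyfun UNIV" unfolding q1_def[abs_def]
    by (intro polyfun_diff polyfun.intros) auto
  moreover have "q2 \<in> polyfun UNIV" unfolding q2_def[abs_def] h_def
    by (simp, intro polyfun_diff function_algebra_sum[OF function_algebra_polyfun] polyfun_power polyfun.coord) auto
  moreover have "q3 \<in> polyfun UNIV" unfolding q3_def[abs_def]
    by (intro polyfun_diff poly F polyfun.coord) auto
  ultimately have P': "finite P'" "P' \<subseteq> polyfun ({T, Y} \<union> range Inl)"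
    unfolding P'_def univ using P(1,2) poly by auto
  have E_sgn: "E v \<longleftrightarrow> E w" if "\<forall>u\<in>P'. sgn (u v) = sgn (u w)" for v w
  proof -
    have "\<forall>p\<in>P. sgn (p (h v)) = sgn (p (h w))" using that by (auto simp: P'_def)
    then have "h v \<in> S \<longleftrightarrow> h w \<in> S" using P(3) by blast
    moreover have "sgn (q1 v) = sgn (q1 w)" "sgn (q2 v) = sgn (q2 w)" "sgn (q3 v) = sgn (q3 w)"
      using that by (auto simp: P'_def)
    then have "q1 v \<ge> 0 \<longleftrightarrow> q1 w \<ge> 0" "q2 v \<ge> 0 \<longleftrightarrow> q2 w \<ge> 0" "q3 v = 0 \<longleftrightarrow> q3 w = 0"
      by (metis linorder_not_le sgn_less, metis linorder_not_le sgn_less, metis sgn_0_0)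
    ultimately show ?thesis unfolding E_def by blast
  qed
  have dis: "{T, Y} \<inter> range Inl = {}" by (auto simp: T_def Y_def)
  have "finite (range (Inl :: 'n \<Rightarrow> 'n + bool))" by simp
  from project_many[OF this P' dis] obtain Q where Q: "finite Q" "Q \<subseteq> polyfun {T, Y}"
    "\<forall>v w. (\<forall>u\<in>Q. sgn (u v) = sgn (u w)) \<longrightarrow>
      (\<exists>w'. (\<forall>i. i \<notin> range Inl \<longrightarrow> w' i = w i) \<and> (\<forall>u\<in>P'. sgn (u v) = sgn (u w')))"
    by (elim exE conjE) (rule that)
  obtain N where N: "\<forall>v\<in>thin_region T Y N. \<forall>w\<in>thin_region T Y N. \<forall>u\<in>Q. sgn (u v) = sgn (u w)"
    using thin_region_signs[OF Q(1,2)] by blast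
  have noE: "\<not> E v" if v: "v \<in> thin_region T Y N" for v
  proof
    assume Ev: "E v"
    \<comment> \<open>The closure makes \<open>K\<close> compact. On \<open>K\<close> the function
      \<open>g\<close> is nonzero, so \<open>F\<close> is positive there by the assumption on zeros
      and has a positive minimum.\<close>
    define K where "K = closure S \<inter> {x. (\<Sum>i\<in>UNIV. (x $ i)^2) \<le> v T} \<inter> {x. 1 \<le> v T * (g x)^2}"
    have "closed K"
      unfolding K_def
      by (intro closed_Int closed_closure closed_Collect_le continuous_intros continuous_on_real_polynomial[OF g])
    moreover have "bounded K"
    proof (rule boundedI[where B = "sqrt (v T)"])
      fix x assume "x \<in> K"
      then have "(\<Sum>i\<in>UNIV. (x $ i)^2) \<le> v T" by (simp add: K_def)
      then show "norm x \<le> sqrt (v T)" by (simp add: norm_vec_def L2_set_def)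
    qed
    ultimately have "compact K" by (simp add: compact_eq_bounded_closed)
    moreover have hK: "h w \<in> K" if "E w" "w T = v T" for w
      using that closure_subset[of S] by (auto simp: E_def q1_def q2_def K_def)
    then have "K \<noteq> {}" using Ev by blast
    ultimately obtain z where z: "z \<in> K" "\<forall>x\<in>K. F z \<le> F x"
      using continuous_attains_inf[OF _ _ continuous_on_real_polynomial[OF F, of K]] by blast
    have "F z \<noteq> 0"
    proof
      assume "F z = 0"
      then have "g z = 0" using z(1) zero by (simp add: K_def)
      then show False using z(1) by (simp add: K_def)
    qed
    then have Fz: "F z > 0" using nonneg[of z] by simp
    obtain n :: nat where n: "v Y / F z < real n" using reals_Archimedean2 by blast
    have vY: "v Y > 0" "v T > 0" using v by (auto simp: thin_region_def)
    have n0: "real n > 0" using n vY Fz by (metis divide_pos_pos less_trans)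
    \<comment> \<open>Dividing by \<open>n\<close> pushes the value of \<open>F\<close> below its
      minimum \<open>F z\<close> while the parameter stays in the thin region. The transferred point
      \<open>w'\<close> then gives a point of \<open>K\<close> with a value that is too
      small.\<close>
    define w where "w = v(Y := v Y / real n)"
    have wT: "w T = v T" by (simp add: w_def T_def Y_def)
    have "v Y / real n * v T ^ N \<le> v Y * v T ^ N"
      using n0 vY by (intro mult_right_mono) (auto simp: divide_le_eq)
    then have "w \<in> thin_region T Y N"
      using v n0 wT by (auto simp: thin_region_def w_def)
    then have "\<forall>u\<in>Q. sgn (u v) = sgn (u w)" using N v by blast
    then obtain w' where w': "\<forall>i. i \<notin> range Inl \<longrightarrow> w' i = w i" "\<forall>u\<in>P'. sgn (u v) = sgn (u w')"
      using Q(3)[rule_format, of v w] by blast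
    have Ew': "E w'" using E_sgn[OF w'(2)] Ev by simp
    have "w' T = w T" "w' Y = w Y" using w'(1) dis by blast+
    then have "F z \<le> F (h w')" using z(2) hK[OF Ew'] wT by simp
    moreover have "F (h w') = v Y / real n"
      using Ew' \<open>w' Y = w Y\<close> by (simp add: E_def q3_def w_def)
    ultimately show False using n Fz n0 by (simp add: field_simps)
  qed
  have "1 \<le> F x * t ^ N" if x: "x \<in> S" "real N + 1 \<le> t" "(\<Sum>i\<in>UNIV. (x $ i)^2) \<le> t" "1 \<le> t * (g x)^2" for x t
  proof -
    \<comment> \<open>The point \<open>x\<close> itself lies in the fibre over
      \<open>(t, F x)\<close>, so this parameter is outside the thin region. Since \<open>t\<close>
      is large and \<open>F x > 0\<close>, only the last condition of the region can fail.\<close>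
    define v where "v i = (case i of Inl j \<Rightarrow> x $ j | Inr b \<Rightarrow> if b then F x else t)" for i
    have hv: "h v = x" and vv: "v T = t" "v Y = F x" by (simp_all add: h_def v_def T_def Y_def)
    have "E v" unfolding E_def q1_def q2_def q3_def hv vv using x by simp
    then have "v \<notin> thin_region T Y N" using noE by blast
    moreover have "F x > 0"
    proof -
      have "g x \<noteq> 0" using x(4) by auto
      then have "F x \<noteq> 0" using zero[of x] x(1) closure_subset by blast
      then show ?thesis using nonneg[of x] by simp
    qed
    ultimately show ?thesis using x(2) by (simp add: thin_region_def vv)
  qed
  then show ?thesis by blast
qed

text \<open>Take \<open>t = r x + 1 / (g x)^2\<close> in the bound on fibres. Multiplying by a power
  of \<open>(g x)^2\<close> clears the denominator, since
  \<open>t * (g x)^2 = r x * (g x)^2 + 1\<close> is a polynomial. The resulting inequality passes to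
  the closure by continuity.\<close>

lemma Lojasiewicz:
  fixes S :: "(real^'n) set"
  assumes S: "semialgebraic S" and F: "real_polynomial_function F" and g: "real_polynomial_function g"
    and nonneg: "\<And>x. F x \<ge> 0" and zero: "\<And>x. x \<in> closure S \<Longrightarrow> F x = 0 \<Longrightarrow> g x = 0"
  shows "\<exists>N w. real_polynomial_function w \<and> (\<forall>x. w x > 0) \<and> (\<forall>x\<in>closure S. g x ^ (2 * N) \<le> w x * F x)"
proof -
  obtain N where N: "\<And>x t. x \<in> S \<Longrightarrow> real N + 1 \<le> t \<Longrightarrow> (\<Sum>i\<in>UNIV. (x $ i)^2) \<le> t \<Longrightarrow> 1 \<le> t * (g x)^2
      \<Longrightarrow> 1 \<le> F x * t ^ N"
    using Lojasiewicz_fibres[OF assms] by blast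
  define r where "r x = real N + 1 + (\<Sum>i\<in>UNIV. (x $ i)^2)" for x :: "real^'n"
  \<comment> \<open>The factor \<open>1 + (g x)^2\<close> pays for the exponent
    \<open>2 * Suc N\<close>, which is positive even when \<open>N = 0\<close>, so that the left
    side vanishes at the zeros of \<open>g\<close>.\<close>
  define w where "w x = (1 + (g x)^2) * (r x * (g x)^2 + 1) ^ N" for x
  have r: "real_polynomial_function r"
    unfolding r_def[abs_def]
    by (intro real_polynomial_function.intros(2,3) real_polynomial_function_sum
        real_polynomial_function_power real_polynomial_component) auto
  have w: "real_polynomial_function w"
    unfolding w_def[abs_def]
    by (intro real_polynomial_function.intros(2-4)
        real_polynomial_function_power r g)
  have r0: "r x \<ge> real N + 1" "r x \<ge> (\<Sum>i\<in>UNIV. (x $ i)^2)" for x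
    by (auto simp: r_def sum_nonneg)
  have pos: "r x * (g x)^2 + 1 > 0" "1 + (g x)^2 > 0" for x
  proof -
    have "r x \<ge> 0" using r0(1)[of x] by linarith
    then show "r x * (g x)^2 + 1 > 0" by (intro add_nonneg_pos mult_nonneg_nonneg) auto
    show "1 + (g x)^2 > 0" by (intro add_pos_nonneg) auto
  qed
  have wpos: "w x > 0" for x unfolding w_def by (intro mult_pos_pos zero_less_power pos)
  have main: "g x ^ (2 * Suc N) \<le> w x * F x" if x: "x \<in> S" for x
  proof (cases "g x = 0")
    case True
    then show ?thesis using wpos[of x] nonneg[of x] by simp
  next
    case False
    define t where "t = r x + 1 / (g x)^2"
    have g2: "(g x)^2 > 0" using False by simp
    have "r x \<ge> 0" using r0(1)[of x] by linarith
    have "t \<ge> r x" using g2 by (simp add: t_def)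
    moreover have tg: "t * (g x)^2 = r x * (g x)^2 + 1" using g2 by (simp add: t_def distrib_right)
    moreover have "r x * (g x)^2 \<ge> 0" using g2 \<open>r x \<ge> 0\<close> by simp
    ultimately have "1 \<le> F x * t ^ N" using r0[of x] by (intro N x) linarith+
    have "g x ^ (2 * Suc N) = (g x)^2 * ((g x)^2) ^ N" by (simp add: power_mult power2_eq_square power_mult_distrib)
    also have "\<dots> \<le> (1 + (g x)^2) * (((g x)^2) ^ N * (F x * t ^ N))"
      using \<open>1 \<le> F x * t ^ N\<close> g2 mult_left_mono[of 1 "F x * t ^ N" "((g x)^2)^N"] by (intro mult_mono) auto
    also have "\<dots> = (1 + (g x)^2) * (t * (g x)^2) ^ N * F x" by (simp add: power_mult_distrib mult_ac)
    also have "\<dots> = w x * F x" by (simp add: tg w_def)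
    finally show ?thesis .
  qed
  have "closed {x. g x ^ (2 * Suc N) \<le> w x * F x}"
    by (intro closed_Collect_le continuous_intros continuous_on_real_polynomial g w F)
  then have "closure S \<subseteq> {x. g x ^ (2 * Suc N) \<le> w x * F x}"
    using main by (intro closure_minimal) auto
  then show ?thesis using w wpos by blast
qed

subsection \<open>Algebraic sets and separation\<close>

definition vanishing_ideal :: "(real^'n) set \<Rightarrow> (('n \<Rightarrow> real) \<Rightarrow> real) set" where
  "vanishing_ideal V = {u \<in> polyfun UNIV. \<forall>x\<in>V. u (\<lambda>i. x $ i) = 0}"

lemma vanishing_ideal_fun_ideal: "fun_ideal (polyfun UNIV) (vanishing_ideal V)"
  by (auto simp: fun_ideal_def vanishing_ideal_def intro: polyfun.intros)

lemma vanishing_ideal_subset_imp: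
  assumes "algebraic_set V" "vanishing_ideal V \<subseteq> vanishing_ideal W"
  shows "W \<subseteq> V"
proof
  fix x assume x: "x \<in> W"
  obtain P where P: "\<forall>p\<in>P. real_polynomial_function p" "V = {x. \<forall>p\<in>P. p x = 0}"
    using assms(1) unfolding algebraic_set_def by blast
  have "p x = 0" if "p \<in> P" for p
  proof -
    have "(\<lambda>v. p (\<chi> i. v i)) \<in> polyfun UNIV"
      using real_polynomial_polyfun[of p id] P(1) that by simp
    then have "(\<lambda>v. p (\<chi> i. v i)) \<in> vanishing_ideal V" using P(2) that by (simp add: vanishing_ideal_def)
    then have "(\<lambda>v. p (\<chi> i. v i)) \<in> vanishing_ideal W" using assms(2) by blast
    then show ?thesis using x by (simp add: vanishing_ideal_def)
  qed
  then show "x \<in> V" using P(2) by blast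
qed

definition algebraic_subset_rel :: "((real^'n) set \<times> (real^'n) set) set" where
  "algebraic_subset_rel = {(V, W). algebraic_set V \<and> algebraic_set W \<and> V \<subset> W}"

text \<open>The ideals of a descending chain ascend; finitely many generators of their union lie in
  one \<open>J D\<close>. The chain of ideals stops there, and an algebraic set is recovered from
  its ideal.\<close>

lemma wf_algebraic_subset_rel: "wf (algebraic_subset_rel :: ((real^'n) set \<times> _) set)"
  unfolding wf_iff_no_infinite_down_chain
proof
  assume "\<exists>V :: nat \<Rightarrow> (real^'n) set. \<forall>i. (V (Suc i), V i) \<in> algebraic_subset_rel"
  then obtain V :: "nat \<Rightarrow> (real^'n) set" where V: "\<And>i. algebraic_set (V i)" "\<And>i. V (Suc i) \<subset> V i"
    unfolding algebraic_subset_rel_def by blast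
  define J where "J i = vanishing_ideal (V i)" for i
  have J: "fun_ideal (polyfun UNIV) (J i)" for i unfolding J_def by (rule vanishing_ideal_fun_ideal)
  have Vdec: "V j \<subseteq> V i" if "i \<le> j" for i j
    using lift_Suc_antimono_le[of V i j] V(2) that by blast
  then have Jmono: "J i \<subseteq> J j" if "i \<le> j" for i j
    using that unfolding J_def vanishing_ideal_def by blast
  have "fun_ideal (polyfun UNIV) (\<Union>i. J i)"
    unfolding fun_ideal_def
  proof (intro conjI ballI)
    show "(\<Union>i. J i) \<subseteq> polyfun UNIV" "(\<lambda>_. 0) \<in> (\<Union>i. J i)"
      using fun_idealD(1,2)[OF J] by blast+
    fix u assume "u \<in> (\<Union>i. J i)"
    then obtain d where u: "u \<in> J d" by blast
    {
      fix w assume "w \<in> (\<Union>i. J i)"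
      then obtain e where "w \<in> J e" by blast
      with u have "u \<in> J (max d e)" "w \<in> J (max d e)" using Jmono[of d "max d e"] Jmono[of e "max d e"] by auto
      then have "(\<lambda>y. u y + w y) \<in> J (max d e)" by (rule fun_idealD(3)[OF J])
      then show "(\<lambda>y. u y + w y) \<in> (\<Union>i. J i)" by blast
    }
    fix c :: "('n \<Rightarrow> real) \<Rightarrow> real" assume "c \<in> polyfun UNIV"
    then have "(\<lambda>y. c y * u y) \<in> J d" by (rule fun_idealD(4)[OF J u])
    then show "(\<lambda>y. c y * u y) \<in> (\<Union>i. J i)" by blast
  qed
  moreover have "noetherian (polyfun (UNIV :: 'n set))" by (rule noetherian_polyfun) simp
  ultimately obtain F where F: "finite F" "F \<subseteq> (\<Union>i. J i)"
    "\<forall>I. fun_ideal (polyfun UNIV) I \<longrightarrow> F \<subseteq> I \<longrightarrow> (\<Union>i. J i) \<subseteq> I"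
    unfolding noetherian_def by meson
  have "\<exists>D. F \<subseteq> J D"
    using F(1,2)
  proof (induction F rule: finite_induct)
    case (insert u F)
    then obtain D e where "F \<subseteq> J D" "u \<in> J e" by auto
    then show ?case using Jmono[of D "max D e"] Jmono[of e "max D e"] by (intro exI[of _ "max D e"]) auto
  qed simp
  then obtain D where "F \<subseteq> J D" by blast
  then have "J (Suc D) \<subseteq> J D" using F(3) J by blast
  then have "V D \<subseteq> V (Suc D)" unfolding J_def by (rule vanishing_ideal_subset_imp[OF V(1)])
  then show False using V(2) by blast
qed

section \<open>Equations and irreducible components of algebraic sets\<close>

lemma algebraic_zero_set: "real_polynomial_function h \<Longrightarrow> algebraic_set {x. h x = 0}"
  unfolding algebraic_set_def by (intro exI[of _ "{h}"]) simp

lemma algebraic_empty: "algebraic_set {}"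
  using algebraic_zero_set[OF real_polynomial_function.intros(2)[of 1]] by simp

lemma algebraic_Int_zero_set:
  assumes "algebraic_set V" "real_polynomial_function h"
  shows "algebraic_set (V \<inter> {x. h x = 0})"
proof -
  obtain P where "\<forall>p\<in>P. real_polynomial_function p" "V = {x. \<forall>p\<in>P. p x = 0}"
    using assms(1) unfolding algebraic_set_def by blast
  then show ?thesis using assms(2) unfolding algebraic_set_def by (intro exI[of _ "insert h P"]) auto
qed

text \<open>The defining family may be infinite. A minimal zero set \<open>Z\<close> of a
  nonnegative polynomial containing \<open>Y\<close> equals \<open>Y\<close>: adding the square of a
  defining polynomial not vanishing on \<open>Z\<close> would make \<open>Z\<close> smaller.\<close>

lemma algebraic_set_equation:
  fixes Y :: "(real^'n) set"
  assumes Y: "algebraic_set Y"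
  shows "\<exists>h. real_polynomial_function h \<and> (\<forall>x. h x \<ge> 0) \<and> Y = {x. h x = 0}"
proof -
  define \<Z> where "\<Z> = {{x. h x = 0} | h. real_polynomial_function h \<and> (\<forall>x. h x \<ge> 0) \<and> Y \<subseteq> {x. h x = 0}}"
  have "{x :: real^'n. (0::real) = 0} \<in> \<Z>"
    unfolding \<Z>_def by (intro CollectI exI[of _ "\<lambda>_. 0"]) auto
  from wfE_min[OF wf_algebraic_subset_rel this] obtain Z where Z: "Z \<in> \<Z>"
    "\<And>V. (V, Z) \<in> algebraic_subset_rel \<Longrightarrow> V \<notin> \<Z>" by blast
  obtain h where h: "real_polynomial_function h" "\<And>x. h x \<ge> 0" "Y \<subseteq> {x. h x = 0}" "Z = {x. h x = 0}"
    using Z(1) unfolding \<Z>_def by blast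
  obtain P where P: "\<forall>p\<in>P. real_polynomial_function p" "Y = {x. \<forall>p\<in>P. p x = 0}"
    using Y unfolding algebraic_set_def by blast
  have "Z \<subseteq> Y"
  proof (rule ccontr)
    assume "\<not> Z \<subseteq> Y"
    then obtain x p where x: "x \<in> Z" "p \<in> P" "p x \<noteq> 0" using P(2) by blast
    define k where "k x = h x + (p x)^2" for x
    have k: "real_polynomial_function k" unfolding k_def[abs_def]
      by (intro real_polynomial_function.intros(3) real_polynomial_function_power h(1)) (use P x in blast)
    have k0: "k y = 0 \<longleftrightarrow> h y = 0 \<and> p y = 0" for y
      unfolding k_def using h(2)[of y] by (simp add: add_nonneg_eq_0_iff)
    have "{x. k x = 0} \<in> \<Z>"
      unfolding \<Z>_def
    proof (intro CollectI exI[of _ k] conjI refl k allI)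
      show "k x \<ge> 0" for x using h(2)[of x] by (simp add: k_def)
      show "Y \<subseteq> {x. k x = 0}" using k0 h(3) P(2) x(2) by blast
    qed
    moreover have "{x. k x = 0} \<subset> Z" using k0 x h(4) by blast
    then have "({x. k x = 0}, Z) \<in> algebraic_subset_rel"
      unfolding algebraic_subset_rel_def using algebraic_zero_set[OF k] algebraic_zero_set[OF h(1)] h(4) by simp
    ultimately show False using Z(2) by blast
  qed
  with h show ?thesis by blast
qed

lemma algebraic_Un:
  assumes "algebraic_set V" "algebraic_set W"
  shows "algebraic_set (V \<union> W)"
proof -
  obtain h k where "real_polynomial_function h" "V = {x. h x = 0}" "real_polynomial_function k" "W = {x. k x = 0}"
    using algebraic_set_equation assms by metis
  moreover from this have "V \<union> W = {x. h x * k x = 0}" by auto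
  ultimately show ?thesis using algebraic_zero_set[OF real_polynomial_function.intros(4)] by metis
qed

lemma algebraic_Union: "finite \<W> \<Longrightarrow> \<forall>W\<in>\<W>. algebraic_set W \<Longrightarrow> algebraic_set (\<Union>\<W>)"
  by (induction \<W> rule: finite_induct) (auto intro: algebraic_empty algebraic_Un)

lemma irreducible_decomposition:
  assumes "algebraic_set Y"
  shows "\<exists>\<W>. finite \<W> \<and> (\<forall>W\<in>\<W>. irreducible_algebraic_set W) \<and> Y = \<Union>\<W>"
  using assms
proof (induction Y rule: wf_induct_rule[OF wf_algebraic_subset_rel])
  case (1 Y)
  show ?case
  proof (cases "irreducible_algebraic_set Y \<or> Y = {}")
    case True
    then show ?thesis
    proof
      assume "Y = {}"
      then show ?thesis by (intro exI[of _ "{}"]) simp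
    next
      assume "irreducible_algebraic_set Y"
      then show ?thesis by (intro exI[of _ "{Y}"]) simp
    qed
  next
    case False
    then obtain V W where VW: "algebraic_set V" "algebraic_set W" "Y = V \<union> W" "Y \<noteq> V" "Y \<noteq> W"
      using 1(2) unfolding irreducible_algebraic_set_def by blast
    then have "(V, Y) \<in> algebraic_subset_rel" "(W, Y) \<in> algebraic_subset_rel"
      using 1(2) unfolding algebraic_subset_rel_def by blast+
    then obtain \<V> \<W> where "finite \<V>" "\<forall>W\<in>\<V>. irreducible_algebraic_set W" "V = \<Union>\<V>"
      "finite \<W>" "\<forall>W\<in>\<W>. irreducible_algebraic_set W" "W = \<Union>\<W>"
      using 1(1) VW(1,2) by meson
    then show ?thesis using VW(3) by (intro exI[of _ "\<V> \<union> \<W>"]) auto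
  qed
qed

text \<open>In a decomposition with the fewest members, none is contained in the union of the
  others. So an equation of \<open>Y'\<close> is not identically zero on \<open>W\<close>.\<close>

lemma irreducible_component:
  assumes "algebraic_set Y" "x \<in> Y"
  shows "\<exists>W Y'. irreducible_algebraic_set W \<and> x \<in> W \<and> algebraic_set Y' \<and> Y = W \<union> Y' \<and> \<not> W \<subseteq> Y'"
proof -
  define C where "C \<W> \<longleftrightarrow> finite \<W> \<and> (\<forall>W\<in>\<W>. irreducible_algebraic_set W) \<and> Y = \<Union>\<W>" for \<W>
  obtain \<W>0 where "C \<W>0" using irreducible_decomposition[OF assms(1)] unfolding C_def by blast
  from ex_has_least_nat[of C, OF this, of card]
  obtain \<W> where W: "C \<W>" "\<And>\<V>. C \<V> \<Longrightarrow> card \<W> \<le> card \<V>" by blast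
  obtain W where w: "W \<in> \<W>" "x \<in> W" using W(1) assms(2) unfolding C_def by blast
  define Y' where "Y' = \<Union>(\<W> - {W})"
  have fin: "finite \<W>" using W(1) by (simp add: C_def)
  have irr: "\<forall>W\<in>\<W>. irreducible_algebraic_set W" using W(1) by (simp add: C_def)
  have "algebraic_set Y'"
    unfolding Y'_def using fin irr by (intro algebraic_Union) (auto simp: irreducible_algebraic_set_def)
  moreover have Y: "Y = W \<union> Y'" using W(1) w(1) unfolding C_def Y'_def by blast
  moreover have "\<not> W \<subseteq> Y'"
  proof
    assume "W \<subseteq> Y'"
    then have "C (\<W> - {W})" using Y fin irr unfolding C_def Y'_def by blast
    then have "card \<W> \<le> card (\<W> - {W})" by (rule W(2))
    then show False using fin w(1) by (metis card_Diff1_less linorder_not_le)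
  qed
  ultimately show ?thesis using w irr by blast
qed

section \<open>Gluing separating polynomials along the zero set of one of them\<close>

definition weakly_separates ::
  "(real^'n) set \<Rightarrow> (real^'n) set \<Rightarrow> (real^'n) set \<Rightarrow> (real^'n \<Rightarrow> real) \<Rightarrow> bool" where
  "weakly_separates Y A B f \<longleftrightarrow> real_polynomial_function f \<and>
     (\<forall>x\<in>closure A \<inter> Y. f x \<ge> 0) \<and> (\<forall>x\<in>closure B \<inter> Y. f x \<le> 0)"

lemma combine_sign:
  fixes a g w :: real
  assumes "w > 0" "a \<ge> 0" "g < 0 \<Longrightarrow> g ^ (2 * N) \<le> w * a^2"
  defines "f \<equiv> 2 * (w * (1 + a^2) * (1 + g^2)) * a + g * g ^ (2 * N)"
  shows "f \<ge> 0" "f = 0 \<Longrightarrow> a = 0 \<and> g = 0"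
proof -
  define W where "W = w * (1 + a^2) * (1 + g^2)"
  have W: "W > 0" unfolding W_def using assms(1) by (intro mult_pos_pos add_pos_nonneg) auto
  have f: "f = 2 * W * a + g * g ^ (2 * N)" by (simp add: f_def W_def)
  have "f \<ge> 0 \<and> (f = 0 \<longrightarrow> a = 0 \<and> g = 0)"
  proof (cases "g < 0")
    case False
    have "0 \<le> 2 * W * a" "0 \<le> g * g ^ (2 * N)" using False W assms(2) by simp_all
    then show ?thesis unfolding f using W by (auto simp: add_nonneg_eq_0_iff)
  next
    case True
    have "\<bar>g\<bar> \<le> 1 + g^2" using power2_eq_square[of g] sum_power2_ge_zero[of "\<bar>g\<bar> - 1" 0] zero_le_power2[of "\<bar>g\<bar> - 1"]
      by (simp add: power2_diff)
    moreover have "a \<le> 1 + a^2" using zero_le_power2[of "a - 1"] assms(2) by (simp add: power2_diff)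
    then have "w * a^2 \<le> w * ((1 + a^2) * a)"
      using assms(1,2) by (simp add: power2_eq_square mult_right_mono)
    with assms(3)[OF True] have "g ^ (2 * N) \<le> w * ((1 + a^2) * a)" by linarith
    ultimately have "\<bar>g\<bar> * g ^ (2 * N) \<le> (1 + g^2) * (w * ((1 + a^2) * a))"
      by (intro mult_mono) (auto intro!: add_nonneg_nonneg)
    then have "- (g * g ^ (2 * N)) \<le> W * a" using True by (simp add: W_def mult_ac)
    then have fW: "f \<ge> W * a" unfolding f by linarith
    moreover have "W * a \<ge> 0" using W assms(2) by simp
    moreover have "a \<noteq> 0"
    proof
      assume "a = 0"
      then have "g ^ (2 * N) \<le> 0" using assms(3)[OF True] by simp
      moreover have "(g^2) ^ N > 0" using True zero_less_power[of "g^2" N] by simp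
      ultimately show False unfolding power_mult by linarith
    qed
    ultimately show ?thesis using W assms(2) by (smt (verit) mult_pos_pos)
  qed
  then show "f \<ge> 0" "f = 0 \<Longrightarrow> a = 0 \<and> g = 0" by blast+
qed

lemma closure_Int_nonneg:
  assumes "real_polynomial_function g" "x \<in> closure (A \<inter> {x. g x > 0})"
  shows "x \<in> closure A" "g x \<ge> 0"
proof -
  show "x \<in> closure A" using assms(2) closure_mono[of "A \<inter> {x. g x > 0}" A] by blast
  have "closed {x. g x \<ge> 0}" by (intro closed_Collect_le continuous_intros continuous_on_real_polynomial assms)
  then have "closure (A \<inter> {x. g x > 0}) \<subseteq> {x. g x \<ge> 0}" by (intro closure_minimal) auto
  then show "g x \<ge> 0" using assms(2) by blast
qed

text \<open>The set where \<open>g\<close> is positive is open. Thus the Lojasiewicz inequality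
  reaches every point of the closures where \<open>g\<close> has the wrong sign.\<close>

lemma in_closure_Int_pos:
  assumes "real_polynomial_function g" "x \<in> closure A" "g x > 0"
  shows "x \<in> closure (A \<inter> {x. g x > 0})"
proof -
  have "open {x. g x > 0}" by (intro open_Collect_less continuous_intros continuous_on_real_polynomial assms)
  from open_Int_closure_subset[OF this, of A] show ?thesis using assms(2,3) by (auto simp: Int_commute)
qed

lemma combine_separation:
  fixes A B Y :: "(real^'n) set"
  assumes A: "semialgebraic A" and B: "semialgebraic B" and Y: "algebraic_set Y"
    and a: "weakly_separates Y A B a" and g: "weakly_separates (Y \<inter> {x. a x = 0}) A B g"
  shows "\<exists>f. weakly_separates Y A B f \<and>
    (\<forall>x\<in>(closure A \<union> closure B) \<inter> Y. f x = 0 \<longrightarrow> a x = 0 \<and> g x = 0)"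
proof -
  have ra: "real_polynomial_function a" and rg: "real_polynomial_function g"
    using a g by (auto simp: weakly_separates_def)
  have rng: "real_polynomial_function (\<lambda>x. - g x)" using rg by blast
  obtain h where h: "real_polynomial_function h" "\<And>x. h x \<ge> 0" "Y = {x. h x = 0}"
    using algebraic_set_equation[OF Y] by blast
  \<comment> \<open>On \<open>S\<close> the sign of \<open>g\<close> is wrong. The zeros of
    \<open>F\<close> below are the points of \<open>Y\<close> with \<open>a = 0\<close>; on
    \<open>Y\<close> itself \<open>F\<close> reduces to \<open>a^2\<close>.\<close>
  define S where "S = (A \<inter> {x. - g x > 0}) \<union> (B \<inter> {x. g x > 0})"
  define F where "F x = (a x)^2 + h x" for x
  have S: "semialgebraic S"
    unfolding S_def by (intro semialgebraic.intros A B rg rng)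
  have F: "real_polynomial_function F" unfolding F_def[abs_def]
    by (intro real_polynomial_function.intros(3) real_polynomial_function_power ra h(1))
  have F0: "F x \<ge> 0" for x using h(2)[of x] by (simp add: F_def)
  have zero: "g x = 0" if "x \<in> closure S" "F x = 0" for x
  proof -
    have "x \<in> Y \<inter> {x. a x = 0}"
      using that(2) h(2)[of x] unfolding F_def h(3) by (simp add: add_nonneg_eq_0_iff)
    moreover have "x \<in> closure (A \<inter> {x. - g x > 0}) \<or> x \<in> closure (B \<inter> {x. g x > 0})"
      using that(1) unfolding S_def closure_Un by blast
    then have "x \<in> closure A \<and> g x \<le> 0 \<or> x \<in> closure B \<and> g x \<ge> 0"
      using closure_Int_nonneg[OF rng, of x A] closure_Int_nonneg[OF rg, of x B] by auto
    ultimately show ?thesis using g unfolding weakly_separates_def by (meson IntI order_antisym)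
  qed
  obtain N w where w: "real_polynomial_function w" "\<And>x. w x > 0"
    "\<And>x. x \<in> closure S \<Longrightarrow> g x ^ (2 * N) \<le> w x * F x"
    using Lojasiewicz[OF S F rg F0 zero] by blast
  define f where "f x = 2 * (w x * (1 + (a x)^2) * (1 + (g x)^2)) * a x + g x * g x ^ (2 * N)" for x
  have f: "real_polynomial_function f" unfolding f_def[abs_def]
    by (intro real_polynomial_function.intros(2-4) real_polynomial_function_power ra rg w(1))
  have onA: "f x \<ge> 0 \<and> (f x = 0 \<longrightarrow> a x = 0 \<and> g x = 0)" if x: "x \<in> closure A" "x \<in> Y" for x
  proof -
    have a0: "a x \<ge> 0" using a x by (simp add: weakly_separates_def)
    have "g x ^ (2 * N) \<le> w x * (a x)^2" if "g x < 0"
    proof -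
      have "x \<in> closure S"
        unfolding S_def closure_Un using in_closure_Int_pos[OF rng x(1)] that by auto
      then show ?thesis using w(3)[of x] x(2) h(3) by (simp add: F_def)
    qed
    from combine_sign[OF w(2) a0 this] show ?thesis by (simp add: f_def)
  qed
  \<comment> \<open>Replacing \<open>a\<close> and \<open>g\<close> by their negatives negates
    \<open>f\<close>, as all remaining factors are even in them. So the case of \<open>A\<close>
    applies.\<close>
  have onB: "f x \<le> 0 \<and> (f x = 0 \<longrightarrow> a x = 0 \<and> g x = 0)" if x: "x \<in> closure B" "x \<in> Y" for x
  proof -
    have a0: "- a x \<ge> 0" using a x by (simp add: weakly_separates_def)
    have "(- g x) ^ (2 * N) \<le> w x * (- a x)^2" if "- g x < 0"
    proof -
      have "x \<in> closure S"
        unfolding S_def closure_Un using in_closure_Int_pos[OF rg x(1)] that by auto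
      then show ?thesis using w(3)[of x] x(2) h(3) by (simp add: F_def)
    qed
    from combine_sign[OF w(2) a0 this] show ?thesis by (simp add: f_def)
  qed
  show ?thesis using f onA onB unfolding weakly_separates_def by blast
qed

theorem separation_on_algebraic_subset:
  fixes M A B Y :: "(real^'n) set"
  assumes A: "semialgebraic A" and B: "semialgebraic B"
    and Y: "algebraic_set Y" "Y \<subseteq> M"
  shows "\<exists>f. weakly_separates Y A B f \<and>
    (\<forall>x\<in>(closure A \<union> closure B) \<inter> Y. f x = 0 \<longrightarrow> x \<in> separation_nullspace M A B)"
  using Y
proof (induction Y rule: wf_induct_rule[OF wf_algebraic_subset_rel])
  case (1 Y)
  show ?case
  proof (cases "\<exists>a. weakly_separates Y A B a \<and> (\<exists>x\<in>Y. a x \<noteq> 0)")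
    case True
    then obtain a where a: "weakly_separates Y A B a" "\<exists>x\<in>Y. a x \<noteq> 0" by blast
    have alg: "algebraic_set (Y \<inter> {x. a x = 0})"
      using a 1(2) by (intro algebraic_Int_zero_set) (auto simp: weakly_separates_def)
    have "(Y \<inter> {x. a x = 0}, Y) \<in> algebraic_subset_rel"
      using alg 1(2) a(2) unfolding algebraic_subset_rel_def by blast
    from 1(1)[OF this alg] 1(3) obtain g where g: "weakly_separates (Y \<inter> {x. a x = 0}) A B g"
      "\<forall>x\<in>(closure A \<union> closure B) \<inter> (Y \<inter> {x. a x = 0}). g x = 0 \<longrightarrow> x \<in> separation_nullspace M A B"
      by blast
    from combine_separation[OF A B 1(2) a(1) g(1)] g(2) show ?thesis by blast
  next
    case False
    have "x \<in> separation_nullspace M A B" if x: "x \<in> Y" for x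
    proof -
      obtain W Y' where W: "irreducible_algebraic_set W" "x \<in> W" "algebraic_set Y'" "Y = W \<union> Y'" "\<not> W \<subseteq> Y'"
        using irreducible_component[OF 1(2) x] by blast
      have "\<not> generically_separable_in W (shadow W A) (shadow W B)"
      proof
        assume "generically_separable_in W (shadow W A) (shadow W B)"
        then obtain f p q where f: "\<exists>x\<in>W. f x \<noteq> 0" "\<forall>x\<in>closure A \<inter> W. f x \<ge> 0" "\<forall>x\<in>closure B \<inter> W. f x \<le> 0"
          and pq: "real_polynomial_function p" "real_polynomial_function q"
          "\<forall>x\<in>W. q x \<noteq> 0 \<and> f x = p x / q x"
          unfolding generically_separable_in_def shadow_def regular_functions_def by blast
        have fpq: "p x * q x = f x * (q x)^2" if "x \<in> W" for x
          using pq(3) that by (simp add: power2_eq_square)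
        obtain h where h: "real_polynomial_function h" "\<And>x. h x \<ge> 0" "Y' = {x. h x = 0}"
          using algebraic_set_equation[OF W(3)] by blast
        \<comment> \<open>On \<open>W\<close> the product \<open>p * q\<close> has the sign of
          \<open>f\<close>. The nonnegative equation \<open>h\<close> of \<open>Y'\<close> extends
          this to \<open>Y\<close> by making the product vanish on the other components.\<close>
        define a where "a x = p x * q x * h x" for x
        have ra: "real_polynomial_function a" unfolding a_def[abs_def]
          by (intro real_polynomial_function.intros(4) pq h)
        have aW: "a x = f x * ((q x)^2 * h x)" if "x \<in> W" for x
          using fpq[OF that] by (simp add: a_def)
        have aY': "a x = 0" if "x \<in> Y'" for x using that h(3) by (simp add: a_def)
        have "weakly_separates Y A B a"
          unfolding weakly_separates_def
        proof (intro conjI ballI ra)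
          fix x assume "x \<in> closure A \<inter> Y"
          then show "a x \<ge> 0" using aY'[of x] aW[of x] f(2) h(2)[of x] W(4)
            by (cases "x \<in> Y'") (auto intro!: mult_nonneg_nonneg)
        next
          fix x assume "x \<in> closure B \<inter> Y"
          then show "a x \<le> 0" using aY'[of x] aW[of x] f(3) h(2)[of x] W(4)
            by (cases "x \<in> Y'") (auto intro!: mult_nonpos_nonneg)
        qed
        then have "\<forall>x\<in>Y. a x = 0" using False by blast
        \<comment> \<open>Irreducibility would force \<open>p * q\<close> or \<open>h\<close> to
          vanish on \<open>W\<close>: the former contradicts \<open>f\<close> being nonzero
          somewhere, the latter \<open>W\<close> not lying in \<open>Y'\<close>.\<close>
        then have "W = (W \<inter> {x. p x * q x = 0}) \<union> (W \<inter> {x. h x = 0})" using W(4) by (auto simp: a_def)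
        moreover have "algebraic_set W" using W(1) by (simp add: irreducible_algebraic_set_def)
        then have "algebraic_set (W \<inter> {x. p x * q x = 0})" "algebraic_set (W \<inter> {x. h x = 0})"
          by (intro algebraic_Int_zero_set real_polynomial_function.intros(4) pq h; assumption)+
        ultimately have "W = W \<inter> {x. p x * q x = 0} \<or> W = W \<inter> {x. h x = 0}"
          using W(1) unfolding irreducible_algebraic_set_def by blast
        moreover have "\<not> W \<subseteq> {x. p x * q x = 0}"
          using f(1) fpq pq(3) by (metis (mono_tags, lifting) mem_Collect_eq mult_eq_0_iff power_not_zero subsetD)
        moreover have "\<not> W \<subseteq> {x. h x = 0}" using W(5) h(3) by blast
        ultimately show False by blast
      qed
      then show ?thesis using W(1,2,4) 1(3) unfolding separation_nullspace_def by blast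
    qed
    \<comment> \<open>All of \<open>Y\<close> lies in the nullspace, so the zero polynomial meets
      the requirement on zeros.\<close>
    then show ?thesis
      by (intro exI[of _ "\<lambda>_. 0"]) (auto simp: weakly_separates_def)
  qed
qed

theorem theorem7p1:
  fixes M A B :: "(real^'n) set"
  assumes "irreducible_algebraic_set M"
    and "semialgebraic A" and "semialgebraic B"
    and "A \<subseteq> M" and "B \<subseteq> M"
    and "A \<inter> B = {}"
    and "separation_nullspace M A B \<inter> (A \<union> B) = {}"
  shows "separable_in M A B \<longleftrightarrow> generically_separable_in M A B"
proof
  assume "separable_in M A B"
  then obtain f where f: "f \<in> regular_functions M" "\<forall>x\<in>A. f x > 0" "\<forall>x\<in>B. f x < 0"
    unfolding separable_in_def by blast
  show "generically_separable_in M A B"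
  proof (cases "A \<union> B = {}")
    \<comment> \<open>Without points in \<open>A\<close> and \<open>B\<close> the function
      \<open>f\<close> might be zero, so a constant replaces it. In the other case \<open>f\<close>
      is nonzero at a point of \<open>A\<close> or \<open>B\<close>.\<close>
    case True
    have "(\<lambda>_. 1) \<in> regular_functions M"
      unfolding regular_functions_def by (auto intro!: exI[of _ "\<lambda>_. 1"])
    moreover have "M \<noteq> {}" using assms(1) by (simp add: irreducible_algebraic_set_def)
    ultimately show ?thesis using True unfolding generically_separable_in_def by fastforce
  next
    case False
    then obtain x where "x \<in> A \<union> B" by blast
    then have "x \<in> M" "f x \<noteq> 0" using f assms(4,5) by force+
    then show ?thesis using f unfolding generically_separable_in_def by (meson less_imp_le)
  qed
next
  have "algebraic_set M" using assms(1) by (simp add: irreducible_algebraic_set_def)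
  from separation_on_algebraic_subset[OF assms(2,3) this order_refl]
  obtain f where f: "weakly_separates M A B f"
    "\<forall>x\<in>(closure A \<union> closure B) \<inter> M. f x = 0 \<longrightarrow> x \<in> separation_nullspace M A B" by blast
  \<comment> \<open>A zero of \<open>f\<close> in \<open>A\<close> or \<open>B\<close> would be a
    point of the nullspace, which is disjoint from both; thus the weak signs become strict.\<close>
  have nz: "f x \<noteq> 0" if "x \<in> A \<union> B" for x
    using f(2) that assms(4,5,7) closure_subset[of A] closure_subset[of B] by blast
  have "f x > 0" if "x \<in> A" for x
    using f(1) nz[of x] that assms(4) closure_subset[of A] unfolding weakly_separates_def by force
  moreover have "f x < 0" if "x \<in> B" for x
    using f(1) nz[of x] that assms(5) closure_subset[of B] unfolding weakly_separates_def by force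
  moreover have "f \<in> regular_functions M"
    using f(1) unfolding regular_functions_def weakly_separates_def
    by (intro CollectI exI[of _ f] exI[of _ "\<lambda>_. 1"]) auto
  ultimately show "separable_in M A B" unfolding separable_in_def by blast
qed

end
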